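(* Let $\Sigma(x)$ be an $\boldsymbol{e}$-invariant partial type such that there is a Lascar tuple $b$ in $\Sigma$ over $\boldsymbol{e}$ with $\boldsymbol{e}\in\operatorname{dcl}(b)$. For such $b$, let $\mathfrak{t}_b$ be the quotient topology on $\operatorname{Gal}_{\mathrm L}(\Sigma,\boldsymbol{e})$ given by the surjective map $\nu_b:S_b(b)\to\operatorname{Gal}_{\mathrm L}(\Sigma,\boldsymbol{e})$. Then $(\operatorname{Gal}_{\mathrm L}(\Sigma,\boldsymbol{e}),\mathfrak{t}_b)$ is a quasi-compact topological group, and the topology $\mathfrak{t}_b$ is independent of the choice of the Lascar tuple $b$ (with $\boldsymbol{e}\in\operatorname{dcl}(b)$).
   Context: $T$ is a complete first-order theory with monster model $\mathfrak{C}$; "small" means of size less than the degree of saturation and strong homogeneity of $\mathfrak{C}$. All sets, tuples, ordinals, cardinals and (elementary sub)models considered are small. A hyperimaginary is an equivalence class $a_E$ of an $\emptyset$-type-definable equivalence relation $E$ on $\mathfrak{C}^\alpha$ ($\alpha$ a small ordinal), with representative $a$. $\boldsymbol{e}=a_E$ is a fixed arbitrary hyperimaginary and $\operatorname{Aut}_{\boldsymbol{e}}(\mathfrak{C})=\{f\in\operatorname{Aut}(\mathfrak{C}): f(\boldsymbol{e})=\boldsymbol{e}\text{ setwise}\}$. For a tuple or set $c$, $\boldsymbol{e}\in\operatorname{dcl}(c)$ means every automorphism fixing $c$ pointwise fixes $\boldsymbol{e}$. $\operatorname{Autf}_{\mathrm L}(\mathfrak{C},\boldsymbol{e})$ is the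 (normal) subgroup of $\operatorname{Aut}_{\boldsymbol{e}}(\mathfrak{C})$ generated by those $f\in\operatorname{Aut}_{\boldsymbol{e}}(\mathfrak{C})$ that fix pointwise some model $M\models T$ with $\boldsymbol{e}\in\operatorname{dcl}(M)$. $c\equiv^{\mathrm L}_{\boldsymbol{e}} d$ means there is $f\in\operatorname{Autf}_{\mathrm L}(\mathfrak{C},\boldsymbol{e})$ with $f(c)=d$. $\Sigma(x)$ is a partial type, $x$ a possibly infinite tuple of variables; $\boldsymbol{e}$-invariant means that for $f\in\operatorname{Aut}_{\boldsymbol{e}}(\mathfrak{C})$, $b\models\Sigma$ iff $f(b)\models\Sigma$. $\Sigma(\mathfrak{C})$ is its solution set. A tuple of realizations of $\Sigma$ is a tuple $(b_i)_{i<\lambda}$ with each $b_i\models\Sigma$. $\operatorname{Aut}_{\boldsymbol{e}}(\Sigma)=\{f\upharpoonright\Sigma(\mathfrak{C}): f\in\operatorname{Aut}_{\boldsymbol{e}}(\mathfrak{C})\}$; $\operatorname{Autf}_{\mathrm L}(\Sigma,\boldsymbol{e})$ is the normal subgroup of all $\sigma\in\operatorname{Aut}_{\boldsymbol{e}}(\Sigma)$ with $b\equiv^{\mathrm L}_{\boldsymbol{e}}\sigma(b)$ for every tuple $b$ (of any length) of realizations of $\Sigma$; $\operatorname{Gal}_{\mathrm L}(\Sigma,\boldsymbol{e})=\operatorname{Aut}_{\boldsymbol{e}}(\Sigma)/\operatorname{Autf}_{\mathrm L}(\Sigma,\boldsymbol{e})$, and $[\sigma]$ denotes the coset of $\sigma$.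 A Lascar tuple in $\Sigma$ over $\boldsymbol{e}$ is a small tuple $b$ of realizations of $\Sigma$ with $\operatorname{Autf}_{\mathrm L}(\Sigma,\boldsymbol{e})=\{\sigma\in\operatorname{Aut}_{\boldsymbol{e}}(\Sigma): b\equiv^{\mathrm L}_{\boldsymbol{e}}\sigma(b)\}$. For a Lascar tuple $b$ with $\boldsymbol{e}\in\operatorname{dcl}(b)$, $S_b(b)=\{\operatorname{tp}(\sigma(b)/b):\sigma\in\operatorname{Aut}_{\boldsymbol{e}}(\Sigma)\}$ with the logic topology (as a subspace of the space of complete types over $b$), and $\nu_b(\operatorname{tp}(\sigma(b)/b))=[\sigma]$, which is well-defined. Quasi-compact means every open cover has a finite subcover (no Hausdorff assumption). *)

theory Defs
  imports
    "HOL-Analysis.Product_Topology"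
    "HOL-Algebra.Bij"
    "HOL-Algebra.Coset"
    "HOL-Algebra.Generated_Groups"
begin

unbundle cardinal_syntax

section \<open>First-order logic\<close>

text \<open>
  A symbol is a name together with its arity, so a language is a pair of sets of such pairs
  (either of which may be empty). The universe of a structure is the whole type \<open>'a\<close>; the values
  of the interpretation at symbols outside the language are irrelevant and are never used.
  The type of variables \<open>'v\<close> is arbitrary; all uses below are with infinite \<open>'v\<close>, so that there
  are always enough variables for quantification.
\<close>

record ('f, 'r, 'a) fo_structure =
  funs :: "('f \<times> nat) set"
  rels :: "('r \<times> nat) set"
  fun_int :: "'f \<Rightarrow> 'a list \<Rightarrow> 'a"
  rel_int :: "'r \<Rightarrow> 'a list \<Rightarrow> bool"

datatype ('f, 'v) tm = Var 'v | Fn 'f "('f, 'v) tm list"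

datatype ('f, 'r, 'v) form =
    Equal "('f, 'v) tm" "('f, 'v) tm"
  | Rel 'r "('f, 'v) tm list"
  | Neg "('f, 'r, 'v) form"
  | Conj "('f, 'r, 'v) form" "('f, 'r, 'v) form"
  | Exists 'v "('f, 'r, 'v) form"

fun wf_tm :: "('f, 'r, 'a) fo_structure \<Rightarrow> ('f, 'v) tm \<Rightarrow> bool" where
  "wf_tm C (Var x) \<longleftrightarrow> True"
| "wf_tm C (Fn f ts) \<longleftrightarrow> (f, length ts) \<in> funs C \<and> (\<forall>t\<in>set ts. wf_tm C t)"

fun fv_tm :: "('f, 'v) tm \<Rightarrow> 'v set" where
  "fv_tm (Var x) = {x}"
| "fv_tm (Fn f ts) = (\<Union>t\<in>set ts. fv_tm t)"

fun wf_form :: "('f, 'r, 'a) fo_structure \<Rightarrow> ('f, 'r, 'v) form \<Rightarrow> bool" where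
  "wf_form C (Equal s t) \<longleftrightarrow> wf_tm C s \<and> wf_tm C t"
| "wf_form C (Rel r ts) \<longleftrightarrow> (r, length ts) \<in> rels C \<and> (\<forall>t\<in>set ts. wf_tm C t)"
| "wf_form C (Neg \<phi>) \<longleftrightarrow> wf_form C \<phi>"
| "wf_form C (Conj \<phi> \<psi>) \<longleftrightarrow> wf_form C \<phi> \<and> wf_form C \<psi>"
| "wf_form C (Exists x \<phi>) \<longleftrightarrow> wf_form C \<phi>"

fun fv :: "('f, 'r, 'v) form \<Rightarrow> 'v set" where
  "fv (Equal s t) = fv_tm s \<union> fv_tm t"
| "fv (Rel r ts) = (\<Union>t\<in>set ts. fv_tm t)"
| "fv (Neg \<phi>) = fv \<phi>"
| "fv (Conj \<phi> \<psi>) = fv \<phi> \<union> fv \<psi>"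
| "fv (Exists x \<phi>) = fv \<phi> - {x}"

fun eval_tm :: "('f, 'r, 'a) fo_structure \<Rightarrow> ('v \<Rightarrow> 'a) \<Rightarrow> ('f, 'v) tm \<Rightarrow> 'a" where
  "eval_tm C v (Var x) = v x"
| "eval_tm C v (Fn f ts) = fun_int C f (map (eval_tm C v) ts)"

text \<open>Satisfaction in the substructure with domain \<open>D\<close>.\<close>

fun sat :: "('f, 'r, 'a) fo_structure \<Rightarrow> 'a set \<Rightarrow> ('v \<Rightarrow> 'a) \<Rightarrow> ('f, 'r, 'v) form \<Rightarrow> bool" where
  "sat C D v (Equal s t) \<longleftrightarrow> eval_tm C v s = eval_tm C v t"
| "sat C D v (Rel r ts) \<longleftrightarrow> rel_int C r (map (eval_tm C v) ts)"
| "sat C D v (Neg \<phi>) \<longleftrightarrow> \<not> sat C D v \<phi>"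
| "sat C D v (Conj \<phi> \<psi>) \<longleftrightarrow> sat C D v \<phi> \<and> sat C D v \<psi>"
| "sat C D v (Exists x \<phi>) \<longleftrightarrow> (\<exists>a\<in>D. sat C D (v(x := a)) \<phi>)"

definition sentences :: "('f, 'r, 'a) fo_structure \<Rightarrow> ('f, 'r, nat) form set" where
  "sentences C = {\<phi>. wf_form C \<phi> \<and> fv \<phi> = {}}"

text \<open>
  Theories are deductively closed. Consistency is not part of this definition; it follows from
  having a model.
\<close>

definition complete_theory :: "('f, 'r, 'a) fo_structure \<Rightarrow> ('f, 'r, nat) form set \<Rightarrow> bool" where
  "complete_theory C T \<longleftrightarrow>
    T \<subseteq> sentences C \<and> (\<forall>\<phi>\<in>sentences C. \<phi> \<in> T \<or> Neg \<phi> \<in> T)"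

definition elementary_substructure :: "('f, 'r, 'a) fo_structure \<Rightarrow> 'a set \<Rightarrow> bool" where
  "elementary_substructure C M \<longleftrightarrow>
    M \<noteq> {} \<and>
    (\<forall>(f, n)\<in>funs C. \<forall>xs. set xs \<subseteq> M \<and> length xs = n \<longrightarrow> fun_int C f xs \<in> M) \<and>
    (\<forall>(\<phi> :: ('f, 'r, nat) form) v. wf_form C \<phi> \<and> range v \<subseteq> M \<longrightarrow>
       (sat C M v \<phi> \<longleftrightarrow> sat C UNIV v \<phi>))"


section \<open>Formulas with parameters and complete types\<close>

text \<open>
  \<open>formulas C I A\<close> are the formulas over the parameter set \<open>A\<close> in the tuple of variables
  \<open>(x\<^sub>i)\<^sub>i\<^sub>\<in>\<^sub>I\<close>: a free occurrence of \<open>Inl i\<close> is the variable \<open>x\<^sub>i\<close> and a free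
  occurrence of \<open>Inr a\<close> is the parameter \<open>a\<close> itself. (A bound variable may be any element of
  \<open>'i + 'a\<close>, its name being immaterial.)
\<close>

definition formulas :: "('f, 'r, 'a) fo_structure \<Rightarrow> 'i set \<Rightarrow> 'a set \<Rightarrow> ('f, 'r, 'i + 'a) form set" where
  "formulas C I A = {\<phi>. wf_form C \<phi> \<and> fv \<phi> \<subseteq> I <+> A}"

definition holds :: "('f, 'r, 'a) fo_structure \<Rightarrow> ('i \<Rightarrow> 'a) \<Rightarrow> ('f, 'r, 'i + 'a) form \<Rightarrow> bool" where
  "holds C t \<phi> \<longleftrightarrow> sat C UNIV (case_sum t id) \<phi>"

definition finitely_satisfiable :: "('f, 'r, 'a) fo_structure \<Rightarrow> ('f, 'r, 'i + 'a) form set \<Rightarrow> bool" where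
  "finitely_satisfiable C p \<longleftrightarrow> (\<forall>F. finite F \<and> F \<subseteq> p \<longrightarrow> (\<exists>t. \<forall>\<phi>\<in>F. holds C t \<phi>))"

definition complete_types :: "('f, 'r, 'a) fo_structure \<Rightarrow> 'i set \<Rightarrow> 'a set \<Rightarrow> ('f, 'r, 'i + 'a) form set set" where
  "complete_types C I A =
    {p. p \<subseteq> formulas C I A \<and> finitely_satisfiable C p \<and>
        (\<forall>\<phi>\<in>formulas C I A. \<phi> \<in> p \<or> Neg \<phi> \<in> p)}"

definition tp :: "('f, 'r, 'a) fo_structure \<Rightarrow> 'i set \<Rightarrow> ('i \<Rightarrow> 'a) \<Rightarrow> 'a set \<Rightarrow> ('f, 'r, 'i + 'a) form set" where
  "tp C I t A = {\<phi> \<in> formulas C I A. holds C t \<phi>}"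

definition logic_topology :: "('f, 'r, 'a) fo_structure \<Rightarrow> 'i set \<Rightarrow> 'a set \<Rightarrow> ('f, 'r, 'i + 'a) form set topology" where
  "logic_topology C I A =
    topology_generated_by ((\<lambda>\<phi>. {p \<in> complete_types C I A. \<phi> \<in> p}) ` formulas C I A)"


section \<open>The monster model\<close>

text \<open>
  \<open>\<kappa>\<close> is the degree of saturation and strong homogeneity. The ordinals below the cardinal \<open>\<kappa>\<close>,
  i.e. the small ordinals, are the elements of \<open>Field \<kappa>\<close>, and \<open>underS \<kappa> \<alpha>\<close> is the set of all
  ordinals below \<open>\<alpha>\<close>. A tuple of length \<open>\<alpha>\<close> is thus an extensional function on \<open>underS \<kappa> \<alpha>\<close>,
  on which a map \<open>f\<close> acts by \<open>compose (underS \<kappa> \<alpha>) f\<close>.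
\<close>

definition tuples :: "'k rel \<Rightarrow> 'k \<Rightarrow> 'b set \<Rightarrow> ('k \<Rightarrow> 'b) set" where
  "tuples \<kappa> \<alpha> B = (underS \<kappa> \<alpha> \<rightarrow>\<^sub>E B)"

definition aut :: "('f, 'r, 'a) fo_structure \<Rightarrow> ('a \<Rightarrow> 'a) set" where
  "aut C = {f. bij f \<and>
    (\<forall>(g, n)\<in>funs C. \<forall>xs. length xs = n \<longrightarrow> f (fun_int C g xs) = fun_int C g (map f xs)) \<and>
    (\<forall>(r, n)\<in>rels C. \<forall>xs. length xs = n \<longrightarrow> rel_int C r (map f xs) = rel_int C r xs)}"

text \<open>
  One-variable types are taken with variable type \<open>nat\<close> rather than \<open>unit\<close> to have bound variables
  available even if \<open>'a\<close> is finite.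
\<close>

definition saturated :: "('f, 'r, 'a) fo_structure \<Rightarrow> 'k rel \<Rightarrow> bool" where
  "saturated C \<kappa> \<longleftrightarrow>
    (\<forall>A. |A| <o \<kappa> \<longrightarrow> (\<forall>p\<in>complete_types C {0::nat} A. \<exists>t. \<forall>\<phi>\<in>p. holds C t \<phi>))"

definition strongly_homogeneous :: "('f, 'r, 'a) fo_structure \<Rightarrow> 'k rel \<Rightarrow> bool" where
  "strongly_homogeneous C \<kappa> \<longleftrightarrow>
    (\<forall>\<alpha>\<in>Field \<kappa>. \<forall>s\<in>tuples \<kappa> \<alpha> UNIV. \<forall>t\<in>tuples \<kappa> \<alpha> UNIV.
       tp C (underS \<kappa> \<alpha>) s {} = tp C (underS \<kappa> \<alpha>) t {} \<longrightarrow>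
       (\<exists>f\<in>aut C. compose (underS \<kappa> \<alpha>) f s = t))"

definition monster_model :: "('f, 'r, 'a) fo_structure \<Rightarrow> ('f, 'r, nat) form set \<Rightarrow> 'k rel \<Rightarrow> bool" where
  "monster_model C T \<kappa> \<longleftrightarrow>
    complete_theory C T \<and> (\<forall>\<phi>\<in>T. \<forall>v. sat C UNIV v \<phi>) \<and>
    Card_order \<kappa> \<and> natLeq <o \<kappa> \<and> |funs C| <o \<kappa> \<and> |rels C| <o \<kappa> \<and>
    saturated C \<kappa> \<and> strongly_homogeneous C \<kappa>"


section \<open>Hyperimaginaries and Lascar strong automorphisms\<close>

definition type_definable_rel :: "('f, 'r, 'a) fo_structure \<Rightarrow> 'k rel \<Rightarrow> 'k \<Rightarrow> ('k \<Rightarrow> 'a) rel \<Rightarrow> bool" where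
  "type_definable_rel C \<kappa> \<alpha> E \<longleftrightarrow>
    (\<exists>\<Phi> \<subseteq> formulas C (underS \<kappa> \<alpha> <+> underS \<kappa> \<alpha>) {}.
       E = {(s, t). s \<in> tuples \<kappa> \<alpha> UNIV \<and> t \<in> tuples \<kappa> \<alpha> UNIV \<and>
                    (\<forall>\<phi>\<in>\<Phi>. holds C (case_sum s t) \<phi>)})"

definition hyperimaginary :: "('f, 'r, 'a) fo_structure \<Rightarrow> 'k rel \<Rightarrow> 'k \<Rightarrow> ('k \<Rightarrow> 'a) set \<Rightarrow> bool" where
  "hyperimaginary C \<kappa> \<alpha> e \<longleftrightarrow>
    \<alpha> \<in> Field \<kappa> \<and>
    (\<exists>E. equiv (tuples \<kappa> \<alpha> UNIV) E \<and> type_definable_rel C \<kappa> \<alpha> E \<and> e \<in> tuples \<kappa> \<alpha> UNIV // E)"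

definition aut_e :: "('f, 'r, 'a) fo_structure \<Rightarrow> 'k rel \<Rightarrow> 'k \<Rightarrow> ('k \<Rightarrow> 'a) set \<Rightarrow> ('a \<Rightarrow> 'a) set" where
  "aut_e C \<kappa> \<alpha> e = {f \<in> aut C. compose (underS \<kappa> \<alpha>) f ` e = e}"

definition in_dcl :: "('f, 'r, 'a) fo_structure \<Rightarrow> 'k rel \<Rightarrow> 'k \<Rightarrow> ('k \<Rightarrow> 'a) set \<Rightarrow> 'a set \<Rightarrow> bool" where
  "in_dcl C \<kappa> \<alpha> e B \<longleftrightarrow> (\<forall>f\<in>aut C. (\<forall>x\<in>B. f x = x) \<longrightarrow> f \<in> aut_e C \<kappa> \<alpha> e)"

definition autf_L :: "('f, 'r, 'a) fo_structure \<Rightarrow> 'k rel \<Rightarrow> 'k \<Rightarrow> ('k \<Rightarrow> 'a) set \<Rightarrow> ('a \<Rightarrow> 'a) set" where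
  "autf_L C \<kappa> \<alpha> e =
    generate (BijGroup UNIV\<lparr>carrier := aut_e C \<kappa> \<alpha> e\<rparr>)
      {f \<in> aut_e C \<kappa> \<alpha> e. \<exists>M. |M| <o \<kappa> \<and> elementary_substructure C M \<and>
          in_dcl C \<kappa> \<alpha> e M \<and> (\<forall>x\<in>M. f x = x)}"

definition lascar_equiv ::
  "('f, 'r, 'a) fo_structure \<Rightarrow> 'k rel \<Rightarrow> 'k \<Rightarrow> ('k \<Rightarrow> 'a) set \<Rightarrow> 'i set \<Rightarrow> ('i \<Rightarrow> 'a) \<Rightarrow> ('i \<Rightarrow> 'a) \<Rightarrow> bool" where
  "lascar_equiv C \<kappa> \<alpha> e I c d \<longleftrightarrow> (\<exists>f\<in>autf_L C \<kappa> \<alpha> e. \<forall>i\<in>I. f (c i) = d i)"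


section \<open>The Galois group of a partial type\<close>

definition partial_type :: "('f, 'r, 'a) fo_structure \<Rightarrow> 'k rel \<Rightarrow> 'k \<Rightarrow> ('f, 'r, 'k + 'a) form set \<Rightarrow> bool" where
  "partial_type C \<kappa> \<eta> \<Sigma> \<longleftrightarrow>
    \<eta> \<in> Field \<kappa> \<and> (\<exists>A. |A| <o \<kappa> \<and> \<Sigma> \<subseteq> formulas C (underS \<kappa> \<eta>) A) \<and> finitely_satisfiable C \<Sigma>"

definition solutions :: "('f, 'r, 'a) fo_structure \<Rightarrow> 'k rel \<Rightarrow> 'k \<Rightarrow> ('f, 'r, 'k + 'a) form set \<Rightarrow> ('k \<Rightarrow> 'a) set" where
  "solutions C \<kappa> \<eta> \<Sigma> = {t \<in> tuples \<kappa> \<eta> UNIV. \<forall>\<phi>\<in>\<Sigma>. holds C t \<phi>}"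

definition e_invariant ::
  "('f, 'r, 'a) fo_structure \<Rightarrow> 'k rel \<Rightarrow> 'k \<Rightarrow> ('k \<Rightarrow> 'a) set \<Rightarrow> 'k \<Rightarrow> ('f, 'r, 'k + 'a) form set \<Rightarrow> bool" where
  "e_invariant C \<kappa> \<alpha> e \<eta> \<Sigma> \<longleftrightarrow>
    (\<forall>f\<in>aut_e C \<kappa> \<alpha> e. \<forall>t\<in>tuples \<kappa> \<eta> UNIV.
       t \<in> solutions C \<kappa> \<eta> \<Sigma> \<longleftrightarrow> compose (underS \<kappa> \<eta>) f t \<in> solutions C \<kappa> \<eta> \<Sigma>)"

definition aut_sol ::
  "('f, 'r, 'a) fo_structure \<Rightarrow> 'k rel \<Rightarrow> 'k \<Rightarrow> ('k \<Rightarrow> 'a) set \<Rightarrow> 'k \<Rightarrow> ('f, 'r, 'k + 'a) form set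
    \<Rightarrow> (('k \<Rightarrow> 'a) \<Rightarrow> 'k \<Rightarrow> 'a) set" where
  "aut_sol C \<kappa> \<alpha> e \<eta> \<Sigma> =
    (\<lambda>f. restrict (compose (underS \<kappa> \<eta>) f) (solutions C \<kappa> \<eta> \<Sigma>)) ` aut_e C \<kappa> \<alpha> e"

definition aut_sol_group ::
  "('f, 'r, 'a) fo_structure \<Rightarrow> 'k rel \<Rightarrow> 'k \<Rightarrow> ('k \<Rightarrow> 'a) set \<Rightarrow> 'k \<Rightarrow> ('f, 'r, 'k + 'a) form set
    \<Rightarrow> (('k \<Rightarrow> 'a) \<Rightarrow> 'k \<Rightarrow> 'a) monoid" where
  "aut_sol_group C \<kappa> \<alpha> e \<eta> \<Sigma> =
    BijGroup (solutions C \<kappa> \<eta> \<Sigma>)\<lparr>carrier := aut_sol C \<kappa> \<alpha> e \<eta> \<Sigma>\<rparr>"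

text \<open>
  A tuple \<open>(b\<^sub>i)\<^sub>i\<^sub><\<^sub>l\<close> of realisations of \<open>\<Sigma>\<close> is a tuple of \<open>\<eta>\<close>-tuples; \<open>case_prod b\<close> is the
  corresponding tuple of elements, indexed by \<open>positions \<kappa> l \<eta>\<close>.
\<close>

definition positions :: "'k rel \<Rightarrow> 'k \<Rightarrow> 'k \<Rightarrow> ('k \<times> 'k) set" where
  "positions \<kappa> l \<eta> = underS \<kappa> l \<times> underS \<kappa> \<eta>"

definition entries :: "'k rel \<Rightarrow> 'k \<Rightarrow> 'k \<Rightarrow> ('k \<Rightarrow> 'k \<Rightarrow> 'a) \<Rightarrow> 'a set" where
  "entries \<kappa> l \<eta> b = case_prod b ` positions \<kappa> l \<eta>"

text \<open>\<open>b \<equiv> \<sigma>(b)\<close> in the sense of Lascar strong types over \<open>e\<close>, for a tuple \<open>b\<close> of realisations:\<close>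

definition lascar_fixes ::
  "('f, 'r, 'a) fo_structure \<Rightarrow> 'k rel \<Rightarrow> 'k \<Rightarrow> ('k \<Rightarrow> 'a) set \<Rightarrow> 'k \<Rightarrow> 'k \<Rightarrow> ('k \<Rightarrow> 'k \<Rightarrow> 'a)
    \<Rightarrow> (('k \<Rightarrow> 'a) \<Rightarrow> 'k \<Rightarrow> 'a) \<Rightarrow> bool" where
  "lascar_fixes C \<kappa> \<alpha> e \<eta> l b \<sigma> \<longleftrightarrow>
    lascar_equiv C \<kappa> \<alpha> e (positions \<kappa> l \<eta>) (case_prod b) (case_prod (compose (underS \<kappa> l) \<sigma> b))"

definition autf_sol ::
  "('f, 'r, 'a) fo_structure \<Rightarrow> 'k rel \<Rightarrow> 'k \<Rightarrow> ('k \<Rightarrow> 'a) set \<Rightarrow> 'k \<Rightarrow> ('f, 'r, 'k + 'a) form set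
    \<Rightarrow> (('k \<Rightarrow> 'a) \<Rightarrow> 'k \<Rightarrow> 'a) set" where
  "autf_sol C \<kappa> \<alpha> e \<eta> \<Sigma> =
    {\<sigma> \<in> aut_sol C \<kappa> \<alpha> e \<eta> \<Sigma>.
       \<forall>l\<in>Field \<kappa>. \<forall>b\<in>tuples \<kappa> l (solutions C \<kappa> \<eta> \<Sigma>). lascar_fixes C \<kappa> \<alpha> e \<eta> l b \<sigma>}"

definition Gal_L ::
  "('f, 'r, 'a) fo_structure \<Rightarrow> 'k rel \<Rightarrow> 'k \<Rightarrow> ('k \<Rightarrow> 'a) set \<Rightarrow> 'k \<Rightarrow> ('f, 'r, 'k + 'a) form set
    \<Rightarrow> (('k \<Rightarrow> 'a) \<Rightarrow> 'k \<Rightarrow> 'a) set monoid" where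
  "Gal_L C \<kappa> \<alpha> e \<eta> \<Sigma> = aut_sol_group C \<kappa> \<alpha> e \<eta> \<Sigma> Mod autf_sol C \<kappa> \<alpha> e \<eta> \<Sigma>"

definition lascar_tuple ::
  "('f, 'r, 'a) fo_structure \<Rightarrow> 'k rel \<Rightarrow> 'k \<Rightarrow> ('k \<Rightarrow> 'a) set \<Rightarrow> 'k \<Rightarrow> ('f, 'r, 'k + 'a) form set
    \<Rightarrow> 'k \<Rightarrow> ('k \<Rightarrow> 'k \<Rightarrow> 'a) \<Rightarrow> bool" where
  "lascar_tuple C \<kappa> \<alpha> e \<eta> \<Sigma> l b \<longleftrightarrow>
    l \<in> Field \<kappa> \<and> b \<in> tuples \<kappa> l (solutions C \<kappa> \<eta> \<Sigma>) \<and>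
    autf_sol C \<kappa> \<alpha> e \<eta> \<Sigma> = {\<sigma> \<in> aut_sol C \<kappa> \<alpha> e \<eta> \<Sigma>. lascar_fixes C \<kappa> \<alpha> e \<eta> l b \<sigma>}"


section \<open>The topology on the Galois group\<close>

text \<open>\<open>tp(\<sigma>(b)/b)\<close>\<close>

definition image_type ::
  "('f, 'r, 'a) fo_structure \<Rightarrow> 'k rel \<Rightarrow> 'k \<Rightarrow> 'k \<Rightarrow> ('k \<Rightarrow> 'k \<Rightarrow> 'a)
    \<Rightarrow> (('k \<Rightarrow> 'a) \<Rightarrow> 'k \<Rightarrow> 'a) \<Rightarrow> ('f, 'r, 'k \<times> 'k + 'a) form set" where
  "image_type C \<kappa> \<eta> l b \<sigma> =
    tp C (positions \<kappa> l \<eta>) (case_prod (compose (underS \<kappa> l) \<sigma> b)) (entries \<kappa> l \<eta> b)"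

definition image_types ::
  "('f, 'r, 'a) fo_structure \<Rightarrow> 'k rel \<Rightarrow> 'k \<Rightarrow> ('k \<Rightarrow> 'a) set \<Rightarrow> 'k \<Rightarrow> ('f, 'r, 'k + 'a) form set
    \<Rightarrow> 'k \<Rightarrow> ('k \<Rightarrow> 'k \<Rightarrow> 'a) \<Rightarrow> ('f, 'r, 'k \<times> 'k + 'a) form set topology" where
  "image_types C \<kappa> \<alpha> e \<eta> \<Sigma> l b =
    subtopology (logic_topology C (positions \<kappa> l \<eta>) (entries \<kappa> l \<eta> b))
      (image_type C \<kappa> \<eta> l b ` aut_sol C \<kappa> \<alpha> e \<eta> \<Sigma>)"

definition nu ::
  "('f, 'r, 'a) fo_structure \<Rightarrow> 'k rel \<Rightarrow> 'k \<Rightarrow> ('k \<Rightarrow> 'a) set \<Rightarrow> 'k \<Rightarrow> ('f, 'r, 'k + 'a) form set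
    \<Rightarrow> 'k \<Rightarrow> ('k \<Rightarrow> 'k \<Rightarrow> 'a) \<Rightarrow> ('f, 'r, 'k \<times> 'k + 'a) form set \<Rightarrow> (('k \<Rightarrow> 'a) \<Rightarrow> 'k \<Rightarrow> 'a) set" where
  "nu C \<kappa> \<alpha> e \<eta> \<Sigma> l b p =
    (THE X. \<exists>\<sigma>\<in>aut_sol C \<kappa> \<alpha> e \<eta> \<Sigma>. p = image_type C \<kappa> \<eta> l b \<sigma> \<and>
       X = autf_sol C \<kappa> \<alpha> e \<eta> \<Sigma> #>\<^bsub>aut_sol_group C \<kappa> \<alpha> e \<eta> \<Sigma>\<^esub> \<sigma>)"

definition quotient_topology :: "'x topology \<Rightarrow> 'y set \<Rightarrow> ('x \<Rightarrow> 'y) \<Rightarrow> 'y topology" where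
  "quotient_topology X Y f = topology (\<lambda>U. U \<subseteq> Y \<and> openin X {x \<in> topspace X. f x \<in> U})"

lemma openin_quotient_topology:
  "openin (quotient_topology X Y f) U \<longleftrightarrow> U \<subseteq> Y \<and> openin X {x \<in> topspace X. f x \<in> U}"
proof -
  have "istopology (\<lambda>U. U \<subseteq> Y \<and> openin X {x \<in> topspace X. f x \<in> U})"
    unfolding istopology_def
  proof (intro conjI allI impI)
    fix U V
    assume "U \<subseteq> Y \<and> openin X {x \<in> topspace X. f x \<in> U}"
      and "V \<subseteq> Y \<and> openin X {x \<in> topspace X. f x \<in> V}"
    moreover have "{x \<in> topspace X. f x \<in> U \<inter> V} =
        {x \<in> topspace X. f x \<in> U} \<inter> {x \<in> topspace X. f x \<in> V}" by blast
    ultimately show "U \<inter> V \<subseteq> Y" "openin X {x \<in> topspace X. f x \<in> U \<inter> V}"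
      by (auto intro: openin_Int)
  next
    fix K
    assume K: "\<forall>U\<in>K. U \<subseteq> Y \<and> openin X {x \<in> topspace X. f x \<in> U}"
    then show "\<Union>K \<subseteq> Y" by blast
    have "{x \<in> topspace X. f x \<in> \<Union>K} = (\<Union>U\<in>K. {x \<in> topspace X. f x \<in> U})" by blast
    then show "openin X {x \<in> topspace X. f x \<in> \<Union>K}" using K by auto
  qed
  then show ?thesis
    by (simp add: quotient_topology_def topology_inverse')
qed

definition Gal_topology ::
  "('f, 'r, 'a) fo_structure \<Rightarrow> 'k rel \<Rightarrow> 'k \<Rightarrow> ('k \<Rightarrow> 'a) set \<Rightarrow> 'k \<Rightarrow> ('f, 'r, 'k + 'a) form set
    \<Rightarrow> 'k \<Rightarrow> ('k \<Rightarrow> 'k \<Rightarrow> 'a) \<Rightarrow> (('k \<Rightarrow> 'a) \<Rightarrow> 'k \<Rightarrow> 'a) set topology" where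
  "Gal_topology C \<kappa> \<alpha> e \<eta> \<Sigma> l b =
    quotient_topology (image_types C \<kappa> \<alpha> e \<eta> \<Sigma> l b) (carrier (Gal_L C \<kappa> \<alpha> e \<eta> \<Sigma>))
      (nu C \<kappa> \<alpha> e \<eta> \<Sigma> l b)"

definition topological_group :: "('g, 'm) monoid_scheme \<Rightarrow> 'g topology \<Rightarrow> bool" where
  "topological_group G X \<longleftrightarrow>
    group G \<and> topspace X = carrier G \<and>
    continuous_map (prod_topology X X) X (\<lambda>(x, y). x \<otimes>\<^bsub>G\<^esub> y) \<and>
    continuous_map X X (\<lambda>x. inv\<^bsub>G\<^esub> x)"

end

theory Submission
  imports Defs "HOL-Analysis.Abstract_Topological_Spaces"
begin

text \<open>
  Write \<open>G\<close> for \<open>Aut\<^sub>e(C)\<close> and \<open>gal f\<close> for the class of \<open>f \<in> G\<close> in the Galois group. If \<open>b\<close> is a Lascar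
  tuple with \<open>e \<in> dcl(b)\<close>, then \<open>gal f\<close> depends only on \<open>tp(f(b)/b)\<close>: by homogeneity, any \<open>g\<close> giving
  the same type is \<open>h \<circ> f \<circ> k\<close> with \<open>h\<close> and \<open>k\<close> fixing \<open>b\<close>, and \<open>gal h = gal k = 1\<close>
  (\<open>gal_eq_of_type\<close>).

  All topologies are compared on one auxiliary space. For a small set \<open>S\<close>, \<open>pair_space S\<close> is the set of
  pairs \<open>(f, g)\<close> in \<open>G\<close>, topologised by the conditions that a formula \<open>\<phi>\<close> holds of finitely many of the
  elements \<open>f(s)\<close>, \<open>g(s)\<close>, \<open>s\<close> with \<open>s \<in> S\<close>. If \<open>S\<close> contains a representative \<open>a\<close> of \<open>e\<close>, this space is
  compact (\<open>compact_pair_space\<close>): a finitely satisfiable set of such conditions is realised in \<open>C\<close> by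
  saturation, the realisation extends to two automorphisms by strong homogeneity, and these lie in \<open>G\<close>
  because \<open>f \<in> G\<close> is equivalent to the type-definable condition \<open>E(a, f(a))\<close>. Saturation being assumed for
  \<open>1\<close>-types, it has to be extended to small tuples (\<open>saturated_small_tuple\<close>).

  If moreover \<open>S\<close> contains the entries of \<open>b\<close>, then \<open>(f, g) \<mapsto> tp(f(b)/b)\<close> is a continuous surjection from a
  compact space to a Hausdorff space, hence a closed map. So \<open>S\<^sub>b(b)\<close> is compact, and \<open>F\<close> is closed for
  \<open>t\<^sub>b\<close> iff \<open>{(f, g). gal f \<in> F}\<close> is closed in \<open>pair_space S\<close> (\<open>closedin_Gal\<close>). The last condition no longer
  mentions \<open>b\<close>; choosing \<open>S\<close> large enough for two Lascar tuples shows that they give the same topology.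

  Continuity of the group operations does not follow formally, since the square of a quotient map need not
  be a quotient map and the Galois group need not be Hausdorff. What can be shown is that for closed \<open>F\<close> the set
  of all \<open>(p, r)\<close> with \<open>\<nu>(p)\<^sup>-\<^sup>1\<nu>(r) \<in> F\<close> is closed in \<open>S\<^sub>b(b) \<times> S\<^sub>b(b)\<close>: it is the image, under a closed
  map, of the set of all \<open>(f, g)\<close> with \<open>gal (f\<^sup>-\<^sup>1g) \<in> F\<close>, and this set is closed since a condition on
  \<open>f\<^sup>-\<^sup>1(g(s))\<close> and \<open>s\<close> is, after applying \<open>f\<close>, one on \<open>g(s)\<close> and \<open>f(s)\<close> (\<open>continuous_division\<close>). A
  topological argument, \<open>topological_group_quotient\<close>, finishes the proof.
\<close>

section \<open>Formulas: locality, renaming and automorphisms\<close>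

lemma finite_fv_tm: "finite (fv_tm t)"
  by (induction t) auto

lemma finite_fv: "finite (fv \<phi>)"
  by (induction \<phi>) (auto simp: finite_fv_tm)

lemma eval_tm_cong: "(\<And>x. x \<in> fv_tm t \<Longrightarrow> v x = w x) \<Longrightarrow> eval_tm C v t = eval_tm C w t"
proof (induction t)
  case (Fn g ts)
  have "map (eval_tm C v) ts = map (eval_tm C w) ts"
    using Fn by (auto intro!: Fn.IH)
  then show ?case by (simp only: eval_tm.simps)
qed simp

lemma sat_cong: "(\<And>x. x \<in> fv \<phi> \<Longrightarrow> v x = w x) \<Longrightarrow> sat C D v \<phi> \<longleftrightarrow> sat C D w \<phi>"
proof (induction \<phi> arbitrary: v w)
  case (Equal s t)
  then have "eval_tm C v s = eval_tm C w s" "eval_tm C v t = eval_tm C w t"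
    by (auto intro: eval_tm_cong)
  then show ?case by simp
next
  case (Rel r ts)
  then have "map (eval_tm C v) ts = map (eval_tm C w) ts"
    by (auto intro!: eval_tm_cong)
  then show ?case by (simp only: sat.simps)
next
  case (Neg \<phi>)
  show ?case using Neg.IH[OF Neg.prems] by simp
next
  case (Conj \<phi> \<psi>)
  have "sat C D v \<phi> \<longleftrightarrow> sat C D w \<phi>" "sat C D v \<psi> \<longleftrightarrow> sat C D w \<psi>"
    using Conj.prems by (auto intro!: Conj.IH)
  then show ?case by simp
next
  case (Exists x \<phi>)
  have "sat C D (v(x := a)) \<phi> \<longleftrightarrow> sat C D (w(x := a)) \<phi>" for a
    using Exists.prems by (intro Exists.IH) auto
  then show ?case by simp
qed

lemma eval_map_tm: "eval_tm C v (map_tm id \<tau> t) = eval_tm C (v \<circ> \<tau>) t"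
  by (induction t) (auto intro!: arg_cong[where f="fun_int C _"])

lemma wf_map_tm: "wf_tm C (map_tm id \<tau> t) \<longleftrightarrow> wf_tm C t"
  by (induction t) auto

lemma fv_map_tm: "fv_tm (map_tm id \<tau> t) = \<tau> ` fv_tm t"
  by (induction t) auto

text \<open>
  Free variables may be mapped to free variables arbitrarily, also non-injectively. The renamed formula is only
  determined up to equivalence, so its bound variables can be chosen fresh; an infinite supply
  of target variables makes that possible.
\<close>
lemma rename_variables:
  fixes \<phi> :: "('f, 'r, 'v) form" and \<tau> :: "'v \<Rightarrow> 'w" and C :: "('f, 'r, 'a) fo_structure"
  assumes "infinite (UNIV :: 'w set)" and "wf_form C \<phi>"
  obtains \<psi> :: "('f, 'r, 'w) form" where "wf_form C \<psi>" and "fv \<psi> \<subseteq> \<tau> ` fv \<phi>"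
    and "\<And>D v. sat C D v \<psi> \<longleftrightarrow> sat C D (v \<circ> \<tau>) \<phi>"
proof -
  have "\<exists>\<psi> :: ('f, 'r, 'w) form. wf_form C \<psi> \<and> fv \<psi> \<subseteq> \<tau> ` fv \<phi> \<and>
      (\<forall>D v. sat C D v \<psi> \<longleftrightarrow> sat C D (v \<circ> \<tau>) \<phi>)"
    using assms(2)
  proof (induction \<phi> arbitrary: \<tau>)
    case (Equal s t)
    then show ?case
      by (intro exI[of _ "Equal (map_tm id \<tau> s) (map_tm id \<tau> t)"])
         (auto simp: eval_map_tm wf_map_tm fv_map_tm o_def)
  next
    case (Rel r ts)
    then show ?case
      by (intro exI[of _ "Rel r (map (map_tm id \<tau>) ts)"])
         (auto simp: eval_map_tm wf_map_tm fv_map_tm o_def)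
  next
    case (Neg \<phi>)
    from Neg.IH[of \<tau>] Neg.prems obtain \<psi> :: "('f, 'r, 'w) form" where "wf_form C \<psi>" "fv \<psi> \<subseteq> \<tau> ` fv \<phi>"
      "\<forall>D v. sat C D v \<psi> \<longleftrightarrow> sat C D (v \<circ> \<tau>) \<phi>" by (auto simp del: comp_apply)
    then show ?case by (intro exI[of _ "Neg \<psi>"]) (auto simp del: comp_apply)
  next
    case (Conj \<phi>1 \<phi>2)
    from Conj.IH(1)[of \<tau>] Conj.prems obtain \<psi>1 :: "('f, 'r, 'w) form" where 1: "wf_form C \<psi>1"
      "fv \<psi>1 \<subseteq> \<tau> ` fv \<phi>1" "\<forall>D v. sat C D v \<psi>1 \<longleftrightarrow> sat C D (v \<circ> \<tau>) \<phi>1" by (auto simp del: comp_apply)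
    from Conj.IH(2)[of \<tau>] Conj.prems obtain \<psi>2 :: "('f, 'r, 'w) form" where 2: "wf_form C \<psi>2"
      "fv \<psi>2 \<subseteq> \<tau> ` fv \<phi>2" "\<forall>D v. sat C D v \<psi>2 \<longleftrightarrow> sat C D (v \<circ> \<tau>) \<phi>2" by (auto simp del: comp_apply)
    from 1 2 show ?case by (intro exI[of _ "Conj \<psi>1 \<psi>2"]) (auto simp del: comp_apply)
  next
    case (Exists x \<phi>)
    \<comment> \<open>A bound variable outside the image of the free ones cannot capture any of them.\<close>
    obtain y where y: "y \<notin> \<tau> ` (fv \<phi> - {x})"
      using assms(1) finite_fv[of \<phi>] ex_new_if_finite by (metis finite_Diff finite_imageI)
    from Exists.IH[of "\<tau>(x := y)"] Exists.prems obtain \<psi> :: "('f, 'r, 'w) form" where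
      \<psi>: "wf_form C \<psi>" "fv \<psi> \<subseteq> (\<tau>(x := y)) ` fv \<phi>"
        "\<forall>D v. sat C D v \<psi> \<longleftrightarrow> sat C D (v \<circ> \<tau>(x := y)) \<phi>"
      unfolding wf_form.simps by blast
    have "sat C D (v(y := a)) \<psi> \<longleftrightarrow> sat C D ((v \<circ> \<tau>)(x := a)) \<phi>" for D v a
    proof -
      have "sat C D (v(y := a)) \<psi> \<longleftrightarrow> sat C D (v(y := a) \<circ> \<tau>(x := y)) \<phi>" using \<psi>(3) by blast
      also have "\<dots> \<longleftrightarrow> sat C D ((v \<circ> \<tau>)(x := a)) \<phi>"
        using y by (intro sat_cong) auto
      finally show ?thesis .
    qed
    moreover have "fv \<psi> - {y} \<subseteq> \<tau> ` (fv \<phi> - {x})" using \<psi>(2) by (auto split: if_splits)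
    ultimately show ?case using \<psi>(1) by (intro exI[of _ "Exists y \<psi>"]) (auto simp del: comp_apply)
  qed
  then show thesis using that by blast
qed

lemma aut_fun_int:
  "f \<in> aut C \<Longrightarrow> (g, length xs) \<in> funs C \<Longrightarrow> f (fun_int C g xs) = fun_int C g (map f xs)"
  unfolding aut_def by blast

lemma aut_rel_int:
  "f \<in> aut C \<Longrightarrow> (r, length xs) \<in> rels C \<Longrightarrow> rel_int C r (map f xs) = rel_int C r xs"
  unfolding aut_def by blast

lemma eval_tm_aut:
  assumes "f \<in> aut C" "wf_tm C t" shows "eval_tm C (f \<circ> v) t = f (eval_tm C v t)"
  using assms(2)
proof (induction t)
  case (Fn g ts)
  have eq: "map (eval_tm C (f \<circ> v)) ts = map f (map (eval_tm C v) ts)"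
    using Fn by (auto simp: o_def)
  have "f (fun_int C g (map (eval_tm C v) ts)) = fun_int C g (map f (map (eval_tm C v) ts))"
    using Fn.prems by (intro aut_fun_int[OF assms(1)]) auto
  then show ?case by (simp only: eval_tm.simps eq)
qed simp

lemma sat_aut:
  assumes "f \<in> aut C" "wf_form C \<phi>" shows "sat C (f ` D) (f \<circ> v) \<phi> \<longleftrightarrow> sat C D v \<phi>"
  using assms(2)
proof (induction \<phi> arbitrary: v)
  case (Equal s t)
  have "inj f" using assms(1) by (simp add: aut_def bij_is_inj)
  then show ?case using Equal assms(1) by (simp add: eval_tm_aut inj_eq del: comp_apply)
next
  case (Rel r ts)
  have eq: "map (eval_tm C (f \<circ> v)) ts = map f (map (eval_tm C v) ts)"
    using Rel assms(1) by (auto intro!: eval_tm_aut)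
  have "rel_int C r (map f (map (eval_tm C v) ts)) = rel_int C r (map (eval_tm C v) ts)"
    using Rel.prems by (intro aut_rel_int[OF assms(1)]) auto
  then show ?case by (simp only: sat.simps eq)
next
  case (Exists x \<phi>)
  have "(f \<circ> v)(x := f a) = f \<circ> v(x := a)" for a by auto
  then show ?case using Exists by (simp del: comp_apply)
qed simp_all

lemma sat_UNIV_aut:
  assumes "f \<in> aut C" "wf_form C \<phi>" shows "sat C UNIV (f \<circ> v) \<phi> \<longleftrightarrow> sat C UNIV v \<phi>"
  using sat_aut[OF assms, of UNIV v] assms(1) by (simp add: aut_def bij_is_surj)

lemma holds_cong:
  assumes "\<phi> \<in> formulas C I A" "\<And>i. i \<in> I \<Longrightarrow> s i = t i"
  shows "holds C s \<phi> \<longleftrightarrow> holds C t \<phi>"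
  unfolding holds_def using assms by (intro sat_cong) (auto simp: formulas_def)

lemma formulas_mono: "I \<subseteq> J \<Longrightarrow> A \<subseteq> B \<Longrightarrow> formulas C I A \<subseteq> formulas C J B"
  by (auto simp: formulas_def)

lemma Neg_formulas: "\<phi> \<in> formulas C I A \<Longrightarrow> Neg \<phi> \<in> formulas C I A"
  by (simp add: formulas_def)

lemma Conj_formulas: "\<phi> \<in> formulas C I A \<Longrightarrow> \<psi> \<in> formulas C I A \<Longrightarrow> Conj \<phi> \<psi> \<in> formulas C I A"
  by (simp add: formulas_def)

lemma holds_Neg [simp]: "holds C t (Neg \<phi>) \<longleftrightarrow> \<not> holds C t \<phi>"
  and holds_Conj [simp]: "holds C t (Conj \<phi> \<psi>) \<longleftrightarrow> holds C t \<phi> \<and> holds C t \<psi>"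
  by (simp_all add: holds_def)

definition verum :: "('f, 'r, 'v) form" where
  "verum = Exists undefined (Equal (Var undefined) (Var undefined))"

lemma verum_formulas [simp]: "verum \<in> formulas C I A"
  by (simp add: verum_def formulas_def)

lemma holds_verum [simp]: "holds C t verum"
  by (simp add: verum_def holds_def)

lemma finite_conjunction:
  assumes "finite F" "F \<subseteq> formulas C I A"
  obtains \<psi> where "\<psi> \<in> formulas C I A" "\<And>t. holds C t \<psi> \<longleftrightarrow> (\<forall>\<phi>\<in>F. holds C t \<phi>)"
proof -
  have "\<exists>\<psi>\<in>formulas C I A. \<forall>t. holds C t \<psi> \<longleftrightarrow> (\<forall>\<phi>\<in>F. holds C t \<phi>)"
    using assms
  proof (induction F)
    case empty
    show ?case by (rule bexI[of _ verum]) auto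
  next
    case (insert \<phi> F)
    then obtain \<psi> where "\<psi> \<in> formulas C I A" "\<forall>t. holds C t \<psi> \<longleftrightarrow> (\<forall>\<phi>\<in>F. holds C t \<phi>)" by auto
    then show ?case using insert.prems by (intro bexI[of _ "Conj \<phi> \<psi>"]) (auto intro: Conj_formulas)
  qed
  then show thesis using that by blast
qed

text \<open>
  This is how all changes of index sets and all substitutions of parameters for variables (or conversely) are
  performed below: \<open>\<tau>\<close> says which variable or parameter replaces which.
\<close>
lemma rename_formula:
  fixes \<phi> :: "('f, 'r, 'i + 'a) form" and \<tau> :: "'i + 'a \<Rightarrow> 'j + 'a" and C :: "('f, 'r, 'a) fo_structure"
  assumes "infinite (UNIV :: 'j set)" and "\<phi> \<in> formulas C I A"
    and "\<tau> ` (I <+> A) \<subseteq> J <+> B"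
  obtains \<psi> where "\<psi> \<in> formulas C J B" and "\<And>t. holds C t \<psi> \<longleftrightarrow> sat C UNIV (case_sum t id \<circ> \<tau>) \<phi>"
proof -
  have "infinite (UNIV :: ('j + 'a) set)"
    using assms(1) by simp
  moreover have "wf_form C \<phi>" "fv \<phi> \<subseteq> I <+> A"
    using assms(2) by (auto simp: formulas_def)
  ultimately obtain \<psi> :: "('f, 'r, 'j + 'a) form" where \<psi>: "wf_form C \<psi>" "fv \<psi> \<subseteq> \<tau> ` fv \<phi>"
    "\<And>D v. sat C D v \<psi> \<longleftrightarrow> sat C D (v \<circ> \<tau>) \<phi>"
    using rename_variables by blast
  have "fv \<psi> \<subseteq> J <+> B" using \<psi>(2) \<open>fv \<phi> \<subseteq> I <+> A\<close> assms(3) by blast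
  then show thesis using that[of \<psi>] \<psi> by (simp add: formulas_def holds_def)
qed

section \<open>Types of small tuples in a saturated, strongly homogeneous structure\<close>

lemma extend_to_complete_type:
  assumes p: "p \<subseteq> formulas C I A" "finitely_satisfiable C p"
  obtains q where "q \<in> complete_types C I A" "p \<subseteq> q"
proof -
  define \<A> where "\<A> = {q. p \<subseteq> q \<and> q \<subseteq> formulas C I A \<and> finitely_satisfiable C q}"
  have "\<exists>q\<in>\<A>. \<forall>X\<in>\<A>. q \<subseteq> X \<longrightarrow> X = q"
  proof (rule subset_Zorn_nonempty)
    show "\<A> \<noteq> {}" using p by (auto simp: \<A>_def)
    fix K assume K: "K \<noteq> {}" "subset.chain \<A> K"
    have "K \<subseteq> \<A>" using K(2) by (simp add: subset.chain_def)
    have "finitely_satisfiable C (\<Union>K)"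
      unfolding finitely_satisfiable_def
    proof (intro allI impI, elim conjE)
      fix F assume "finite F" "F \<subseteq> \<Union>K"
      then obtain X where "X \<in> K" "F \<subseteq> X"
        using finite_subset_Union_chain[of F K \<A>] K by metis
      then have "finitely_satisfiable C X" using \<open>K \<subseteq> \<A>\<close> by (auto simp: \<A>_def)
      then show "\<exists>t. \<forall>\<phi>\<in>F. holds C t \<phi>" using \<open>F \<subseteq> X\<close> \<open>finite F\<close>
        unfolding finitely_satisfiable_def by blast
    qed
    then show "\<Union>K \<in> \<A>" using \<open>K \<subseteq> \<A>\<close> K(1) unfolding \<A>_def by blast
  qed
  then obtain q where q: "q \<in> \<A>" and max: "\<And>X. X \<in> \<A> \<Longrightarrow> q \<subseteq> X \<Longrightarrow> X = q" by blast
  have fs: "finitely_satisfiable C q" "q \<subseteq> formulas C I A" "p \<subseteq> q" using q by (auto simp: \<A>_def)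
  have "\<phi> \<in> q \<or> Neg \<phi> \<in> q" if \<phi>: "\<phi> \<in> formulas C I A" for \<phi>
  proof (rule ccontr)
    have unsat: "\<exists>F. finite F \<and> F \<subseteq> q \<and> (\<forall>t. (\<forall>\<psi>\<in>F. holds C t \<psi>) \<longrightarrow> \<not> holds C t \<xi>)"
      if "\<xi> \<in> formulas C I A" "\<xi> \<notin> q" for \<xi>
    proof -
      have "insert \<xi> q \<notin> \<A>" using max[of "insert \<xi> q"] that(2) by blast
      then have "\<not> finitely_satisfiable C (insert \<xi> q)" using fs that(1) by (auto simp: \<A>_def)
      then obtain F where F: "finite F" "F \<subseteq> insert \<xi> q" "\<not> (\<exists>t. \<forall>\<phi>\<in>F. holds C t \<phi>)"
        unfolding finitely_satisfiable_def by blast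
      then have "finite (F - {\<xi>})" "F - {\<xi>} \<subseteq> q"
        "\<forall>t. (\<forall>\<psi>\<in>F - {\<xi>}. holds C t \<psi>) \<longrightarrow> \<not> holds C t \<xi>" by blast+
      then show ?thesis by blast
    qed
    assume "\<not> (\<phi> \<in> q \<or> Neg \<phi> \<in> q)"
    then have "\<phi> \<notin> q" "Neg \<phi> \<notin> q" by auto
    from unsat[OF \<phi> this(1)] unsat[OF Neg_formulas[OF \<phi>] this(2)] obtain F1 F2 where
      F: "finite F1" "finite F2" "F1 \<subseteq> q" "F2 \<subseteq> q"
      "\<forall>t. (\<forall>\<psi>\<in>F1. holds C t \<psi>) \<longrightarrow> \<not> holds C t \<phi>"
      "\<forall>t. (\<forall>\<psi>\<in>F2. holds C t \<psi>) \<longrightarrow> holds C t \<phi>" by auto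
    then have "finite (F1 \<union> F2)" "F1 \<union> F2 \<subseteq> q" by auto
    then obtain t where "\<forall>\<psi>\<in>F1 \<union> F2. holds C t \<psi>"
      using fs(1) unfolding finitely_satisfiable_def by blast
    then show False using F by blast
  qed
  then have "q \<in> complete_types C I A" using fs by (simp add: complete_types_def)
  then show thesis using that fs by blast
qed

lemma tp_complete_type: "tp C I t A \<in> complete_types C I A"
  unfolding complete_types_def finitely_satisfiable_def
  using Neg_formulas by (auto simp: tp_def intro!: exI[of _ t])

lemma sat_foldr_Exists:
  "sat C UNIV v (foldr Exists xs \<phi>) \<longleftrightarrow> (\<exists>w. (\<forall>y. y \<notin> set xs \<longrightarrow> w y = v y) \<and> sat C UNIV w \<phi>)"
proof (induction xs arbitrary: v)
  case Nil
  have "w = v" if "\<forall>y. y \<notin> set [] \<longrightarrow> w y = v y" for w using that by auto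
  then show ?case by auto
next
  case (Cons x xs)
  have "sat C UNIV v (foldr Exists (x # xs) \<phi>) \<longleftrightarrow>
      (\<exists>a w. (\<forall>y. y \<notin> set xs \<longrightarrow> w y = (v(x := a)) y) \<and> sat C UNIV w \<phi>)"
    using Cons by simp
  also have "\<dots> \<longleftrightarrow> (\<exists>w. (\<forall>y. y \<notin> set (x # xs) \<longrightarrow> w y = v y) \<and> sat C UNIV w \<phi>)"
  proof
    assume "\<exists>w. (\<forall>y. y \<notin> set (x # xs) \<longrightarrow> w y = v y) \<and> sat C UNIV w \<phi>"
    then obtain w where "\<forall>y. y \<notin> set (x # xs) \<longrightarrow> w y = v y" "sat C UNIV w \<phi>" by blast
    then show "\<exists>a w. (\<forall>y. y \<notin> set xs \<longrightarrow> w y = (v(x := a)) y) \<and> sat C UNIV w \<phi>"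
      by (intro exI[of _ "w x"] exI[of _ w]) auto
  next
    assume "\<exists>a w. (\<forall>y. y \<notin> set xs \<longrightarrow> w y = (v(x := a)) y) \<and> sat C UNIV w \<phi>"
    then obtain a w where "\<forall>y. y \<notin> set xs \<longrightarrow> w y = (v(x := a)) y" "sat C UNIV w \<phi>" by blast
    then show "\<exists>w. (\<forall>y. y \<notin> set (x # xs) \<longrightarrow> w y = v y) \<and> sat C UNIV w \<phi>"
      by (intro exI[of _ w]) auto
  qed
  finally show ?case .
qed

lemma foldr_Exists_formula:
  "fv (foldr Exists xs \<phi>) = fv \<phi> - set xs" "wf_form C (foldr Exists xs \<phi>) = wf_form C \<phi>"
  by (induction xs) auto

text \<open>
  That \<open>x\<close>, put at place \<open>i\<close>, extends the partial tuple \<open>m\<close> to one satisfying \<open>F\<close> is expressible in the single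
  variable \<open>x\<close>: the unassigned variables are quantified away, the assigned ones become parameters.
\<close>
lemma projection_formula:
  fixes F :: "('f, 'r, 'i + 'a) form set" and C :: "('f, 'r, 'a) fo_structure"
  assumes "finite F" "F \<subseteq> formulas C I A"
  obtains \<psi> :: "('f, 'r, nat + 'a) form" where "\<psi> \<in> formulas C {0} (A \<union> m ` J)"
    and "\<And>u. holds C u \<psi> \<longleftrightarrow> (\<exists>t. (\<forall>j\<in>J - {i}. t j = m j) \<and> t i = u 0 \<and> (\<forall>\<phi>\<in>F. holds C t \<phi>))"
proof -
  obtain \<theta> where \<theta>: "\<theta> \<in> formulas C I A" "\<And>t. holds C t \<theta> \<longleftrightarrow> (\<forall>\<phi>\<in>F. holds C t \<phi>)"
    using finite_conjunction[OF assms] by blast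
  define V where "V = fv \<theta> \<inter> Inl ` (- insert i J)"
  have "finite V" by (simp add: V_def finite_fv)
  then obtain xs where xs: "set xs = V" using finite_list by blast
  define \<xi> where "\<xi> = foldr Exists xs \<theta>"
  have V_Inr: "Inr a \<notin> V" for a by (auto simp: V_def)
  have "\<xi> \<in> formulas C (insert i J) A"
    using \<theta>(1) by (auto simp: \<xi>_def formulas_def foldr_Exists_formula xs V_def)
  define \<tau> :: "'i + 'a \<Rightarrow> nat + 'a" where
    "\<tau> = case_sum (\<lambda>j. if j = i then Inl 0 else Inr (m j)) Inr"
  have "\<tau> ` (insert i J <+> A) \<subseteq> {0} <+> (A \<union> m ` J)" by (auto simp: \<tau>_def)
  then obtain \<psi> where \<psi>: "\<psi> \<in> formulas C {0} (A \<union> m ` J)"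
    "\<And>u. holds C u \<psi> \<longleftrightarrow> sat C UNIV (case_sum u id \<circ> \<tau>) \<xi>"
    using rename_formula[OF _ \<open>\<xi> \<in> _\<close>, of \<tau> "{0::nat}"] by auto
  have "holds C u \<psi> \<longleftrightarrow> (\<exists>t. (\<forall>j\<in>J - {i}. t j = m j) \<and> t i = u 0 \<and> (\<forall>\<phi>\<in>F. holds C t \<phi>))" for u
  proof -
    have "holds C u \<psi> \<longleftrightarrow> (\<exists>w. (\<forall>y. y \<notin> V \<longrightarrow> w y = (case_sum u id \<circ> \<tau>) y) \<and> sat C UNIV w \<theta>)"
      using \<psi>(2) by (simp add: \<xi>_def sat_foldr_Exists xs)
    also have "\<dots> \<longleftrightarrow> (\<exists>t. (\<forall>j\<in>J - {i}. t j = m j) \<and> t i = u 0 \<and> holds C t \<theta>)"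
    proof safe
      fix w assume w: "\<forall>y. y \<notin> V \<longrightarrow> w y = (case_sum u id \<circ> \<tau>) y" "sat C UNIV w \<theta>"
      have "w = case_sum (w \<circ> Inl) id"
      proof
        fix y show "w y = case_sum (w \<circ> Inl) id y"
          using w(1) V_Inr by (cases y) (auto simp: \<tau>_def)
      qed
      then have "holds C (w \<circ> Inl) \<theta>" using w(2) by (simp add: holds_def)
      moreover have "Inl j \<notin> V" if "j \<in> insert i J" for j using that by (auto simp: V_def)
      ultimately show "\<exists>t. (\<forall>j\<in>J - {i}. t j = m j) \<and> t i = u 0 \<and> holds C t \<theta>"
        using w(1) by (intro exI[of _ "w \<circ> Inl"]) (auto simp: \<tau>_def)
    next
      fix t assume t: "\<forall>j\<in>J - {i}. t j = m j" "t i = u 0" "holds C t \<theta>"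
      define w where "w y = (if y \<in> V then case_sum t id y else (case_sum u id \<circ> \<tau>) y)" for y
      have "w y = case_sum t id y" if "y \<in> fv \<theta>" for y
        using that t by (cases y) (auto simp: w_def V_def \<tau>_def)
      then have "sat C UNIV w \<theta>" using t(3) sat_cong[of \<theta> w "case_sum t id"] by (simp add: holds_def)
      then show "\<exists>w. (\<forall>y. y \<notin> V \<longrightarrow> w y = (case_sum u id \<circ> \<tau>) y) \<and> sat C UNIV w \<theta>"
        by (intro exI[of _ w]) (simp add: w_def)
    qed
    finally show ?thesis using \<theta>(2) by simp
  qed
  then show thesis using that \<psi>(1) by blast
qed

lemma small_image: "|A| <o \<kappa> \<Longrightarrow> |f ` A| <o \<kappa>"
  using card_of_image ordLeq_ordLess_trans by blast

lemma small_subset: "|A| <o \<kappa> \<Longrightarrow> B \<subseteq> A \<Longrightarrow> |B| <o \<kappa>"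
  using card_of_mono1 ordLeq_ordLess_trans by blast

lemma infinite_Field:
  assumes "Card_order \<kappa>" "natLeq <o \<kappa>"
  shows "infinite (Field \<kappa>)"
proof -
  have "\<kappa> =o |Field \<kappa>|"
    using card_of_Field_ordIso[OF assms(1)] by (rule ordIso_symmetric)
  then have "natLeq \<le>o |Field \<kappa>|"
    by (rule ordLeq_ordIso_trans[OF ordLess_imp_ordLeq[OF assms(2)]])
  then show ?thesis using infinite_iff_natLeq_ordLeq[of "Field \<kappa>"] by simp
qed

lemma small_Plus:
  assumes "Card_order \<kappa>" "natLeq <o \<kappa>" "|A| <o \<kappa>" "|B| <o \<kappa>"
  shows "|A <+> B| <o \<kappa>"
  by (rule card_of_Plus_ordLess_infinite_Field[OF infinite_Field[OF assms(1,2)] assms(1,3,4)])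

lemma small_Un:
  assumes "Card_order \<kappa>" "natLeq <o \<kappa>" "|A| <o \<kappa>" "|B| <o \<kappa>"
  shows "|A \<union> B| <o \<kappa>"
  using small_Plus[OF assms] card_of_Un_Plus_ordLeq ordLeq_ordLess_trans by blast

lemma small_finite:
  assumes "natLeq <o \<kappa>" "finite A"
  shows "|A| <o \<kappa>"
  using assms finite_iff_ordLess_natLeq ordLess_transitive by blast

lemma small_Times:
  assumes "Card_order \<kappa>" "natLeq <o \<kappa>" "|A| <o \<kappa>" "|B| <o \<kappa>"
  shows "|A \<times> B| <o \<kappa>"
proof (cases "finite (A <+> B)")
  case True
  then have "finite A" "finite B" by auto
  then show ?thesis by (intro small_finite[OF assms(2)] finite_cartesian_product)
next
  case False
  let ?P = "A <+> B"
  have "(x, y) \<in> map_prod projl projr ` (?P \<times> ?P)" if "x \<in> A" "y \<in> B" for x y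
    using that by (intro image_eqI[of _ _ "(Inl x, Inr y)"]) auto
  then have "A \<times> B \<subseteq> map_prod projl projr ` (?P \<times> ?P)" by blast
  moreover have "|?P \<times> ?P| <o \<kappa>"
    using ordIso_ordLess_trans[OF card_of_Times_same_infinite[OF False] small_Plus[OF assms]] .
  ultimately show ?thesis using small_subset[OF small_image] by blast
qed

text \<open>
  Saturation for \<open>1\<close>-types gives saturation for types of small tuples. A maximal partial assignment
  of values that keeps every finite part of the type satisfiable is total: the formulas saying that a further
  value \<open>x\<close> is admissible for a given finite part form a partial \<open>1\<close>-type over the parameters and the
  values assigned so far.
\<close>
lemma saturated_small_tuple:
  fixes C :: "('f, 'r, 'a) fo_structure" and \<Phi> :: "('f, 'r, 'i + 'a) form set" and \<kappa> :: "'k rel"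
  assumes "saturated C \<kappa>" and \<kappa>: "Card_order \<kappa>" "natLeq <o \<kappa>"
    and I: "|I| <o \<kappa>" and A: "|A| <o \<kappa>"
    and \<Phi>: "\<Phi> \<subseteq> formulas C I A" "finitely_satisfiable C \<Phi>"
  obtains t where "\<And>\<phi>. \<phi> \<in> \<Phi> \<Longrightarrow> holds C t \<phi>"
proof -
  \<comment> \<open>Partial assignments as graphs; the members are functional because each is part of a total tuple.\<close>
  define \<A> where "\<A> = {m. m \<subseteq> I \<times> UNIV \<and>
    (\<forall>F. finite F \<and> F \<subseteq> \<Phi> \<longrightarrow> (\<exists>t. (\<forall>(i, x)\<in>m. t i = x) \<and> (\<forall>\<phi>\<in>F. holds C t \<phi>)))}"
  have sv: "x = y" if "m \<in> \<A>" "(i, x) \<in> m" "(i, y) \<in> m" for m i x y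
  proof -
    from that(1) obtain t where "\<forall>(i, x)\<in>m. t i = x" unfolding \<A>_def by blast
    then have "t i = x" "t i = y" using that(2,3) by auto
    then show ?thesis by simp
  qed
  have "\<exists>m\<in>\<A>. \<forall>X\<in>\<A>. m \<subseteq> X \<longrightarrow> X = m"
  proof (rule subset_Zorn_nonempty)
    have "{} \<in> \<A>" using \<Phi>(2) by (simp add: \<A>_def finitely_satisfiable_def)
    then show "\<A> \<noteq> {}" by blast
    fix K assume K: "K \<noteq> {}" "subset.chain \<A> K"
    have KA: "K \<subseteq> \<A>" using K(2) by (simp add: subset.chain_def)
    have svK: "x = y" if ix: "(i, x) \<in> \<Union>K" and iy: "(i, y) \<in> \<Union>K" for i x y
    proof -
      obtain m where "m \<in> K" "{(i, x), (i, y)} \<subseteq> m"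
        using finite_subset_Union_chain[of "{(i, x), (i, y)}" K \<A>] K ix iy by auto
      then have "m \<in> \<A>" "(i, x) \<in> m" "(i, y) \<in> m" using KA by auto
      then show ?thesis by (rule sv)
    qed
    have "\<exists>t. (\<forall>(i, x)\<in>\<Union>K. t i = x) \<and> (\<forall>\<phi>\<in>F. holds C t \<phi>)" if F: "finite F" "F \<subseteq> \<Phi>" for F
    proof -
      \<comment> \<open>Only the finitely many variables \<open>V\<close> of \<open>F\<close> matter; one member of the chain assigns all of
        those that the union assigns.\<close>
      define V where "V = {i. Inl i \<in> (\<Union>\<phi>\<in>F. fv \<phi>)}"
      have "finite (Inl -` (\<Union>\<phi>\<in>F. fv \<phi>) :: 'i set)"
        using F(1) by (intro finite_vimageI) (auto simp: finite_fv)
      then have "finite V" by (simp add: V_def vimage_def)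
      define val where "val i = (THE x. (i, x) \<in> \<Union>K)" for i
      have val: "val i = x" if "(i, x) \<in> \<Union>K" for i x
        unfolding val_def by (rule the_equality, rule that, erule svK[OF _ that])
      have "\<Union>K \<inter> V \<times> UNIV \<subseteq> (\<lambda>i. (i, val i)) ` V"
      proof safe
        fix i x Y assume "(i, x) \<in> Y" "Y \<in> K" "i \<in> V"
        then have "val i = x" by (intro val UnionI)
        then show "(i, x) \<in> (\<lambda>i. (i, val i)) ` V" using \<open>i \<in> V\<close> by (intro image_eqI) simp_all
      qed
      then have "finite (\<Union>K \<inter> V \<times> UNIV)" by (rule finite_subset) (intro finite_imageI \<open>finite V\<close>)
      then obtain m where m: "m \<in> K" "\<Union>K \<inter> V \<times> UNIV \<subseteq> m"
        using finite_subset_Union_chain[of "\<Union>K \<inter> V \<times> UNIV" K \<A>] K by auto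
      obtain t where t: "\<forall>(i, x)\<in>m. t i = x" "\<forall>\<phi>\<in>F. holds C t \<phi>"
        using m(1) KA F unfolding \<A>_def by blast
      define t' where "t' i = (if i \<in> V then t i else val i)" for i
      have "holds C t' \<phi>" if "\<phi> \<in> F" for \<phi>
      proof -
        have "sat C UNIV (case_sum t' id) \<phi> \<longleftrightarrow> sat C UNIV (case_sum t id) \<phi>"
          using that by (intro sat_cong) (auto simp: t'_def V_def split: sum.split)
        then show ?thesis using t(2) that by (simp add: holds_def)
      qed
      moreover have "t' i = x" if "(i, x) \<in> \<Union>K" for i x
        using that val m(2) t(1) by (cases "i \<in> V") (auto simp: t'_def)
      ultimately show ?thesis by blast
    qed
    then show "\<Union>K \<in> \<A>" using KA unfolding \<A>_def by blast
  qed
  then obtain m where m: "m \<in> \<A>" and max: "\<And>X. X \<in> \<A> \<Longrightarrow> m \<subseteq> X \<Longrightarrow> X = m" by blast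
  define val where "val i = (THE x. (i, x) \<in> m)" for i
  have val: "val i = x" if "(i, x) \<in> m" for i x
    unfolding val_def by (rule the_equality, rule that, erule sv[OF m _ that])
  define J where "J = fst ` m"
  have J: "J \<subseteq> I" using m by (auto simp: J_def \<A>_def)
  have m_val: "(\<forall>(i, x)\<in>m. t i = x) \<longleftrightarrow> (\<forall>j\<in>J. t j = val j)" for t :: "'i \<Rightarrow> 'a"
    using val by (force simp: J_def)
  have ext: "\<exists>t. (\<forall>j\<in>J. t j = val j) \<and> (\<forall>\<phi>\<in>F. holds C t \<phi>)" if "finite F" "F \<subseteq> \<Phi>" for F
  proof -
    have "\<exists>t. (\<forall>(i, x)\<in>m. t i = x) \<and> (\<forall>\<phi>\<in>F. holds C t \<phi>)"
      using m that unfolding \<A>_def by blast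
    then show ?thesis by (simp only: m_val)
  qed
  have "i \<in> J" if i: "i \<in> I" for i
  proof (rule ccontr)
    assume "i \<notin> J"
    define good where "good F x \<longleftrightarrow> (\<exists>t. (\<forall>j\<in>J. t j = val j) \<and> t i = x \<and> (\<forall>\<phi>\<in>F. holds C t \<phi>))" for F x
    let ?B = "A \<union> val ` J"
    have B: "|?B| <o \<kappa>"
      using small_Un[OF \<kappa> A] small_image small_subset[OF I J] by blast
    define p where "p = {\<psi> \<in> formulas C {0::nat} ?B. \<exists>F. finite F \<and> F \<subseteq> \<Phi> \<and>
        (\<forall>u. holds C u \<psi> \<longleftrightarrow> good F (u 0))}"
    have "finitely_satisfiable C p"
      unfolding finitely_satisfiable_def
    proof (intro allI impI, elim conjE)
      fix G assume G: "finite G" "G \<subseteq> p"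
      then have "\<forall>\<psi>\<in>G. \<exists>F. finite F \<and> F \<subseteq> \<Phi> \<and> (\<forall>u. holds C u \<psi> \<longleftrightarrow> good F (u 0))"
        unfolding p_def by blast
      then obtain \<F> where \<F>: "\<And>\<psi>. \<psi> \<in> G \<Longrightarrow> finite (\<F> \<psi>) \<and> \<F> \<psi> \<subseteq> \<Phi> \<and>
          (\<forall>u. holds C u \<psi> \<longleftrightarrow> good (\<F> \<psi>) (u 0))" by metis
      have "finite (\<Union>(\<F> ` G))" "\<Union>(\<F> ` G) \<subseteq> \<Phi>" using G(1) \<F> by blast+
      then obtain t where t: "\<forall>j\<in>J. t j = val j" "\<forall>\<phi>\<in>\<Union>(\<F> ` G). holds C t \<phi>"
        using ext by blast
      then have "good (\<F> \<psi>) (t i)" if "\<psi> \<in> G" for \<psi>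
        using that unfolding good_def by blast
      then have "\<forall>\<psi>\<in>G. holds C (\<lambda>_. t i) \<psi>" using \<F> by blast
      then show "\<exists>u. \<forall>\<psi>\<in>G. holds C u \<psi>" by blast
    qed
    then obtain q where q: "q \<in> complete_types C {0} ?B" "p \<subseteq> q"
      using extend_to_complete_type[of p C "{0}" ?B] by (auto simp: p_def)
    then obtain u where u: "\<forall>\<psi>\<in>q. holds C u \<psi>"
      using assms(1) B unfolding saturated_def by blast
    have u_good: "good F (u 0)" if F: "finite F" "F \<subseteq> \<Phi>" for F
    proof -
      have "F \<subseteq> formulas C I A" using F(2) \<Phi>(1) by blast
      then obtain \<psi> where \<psi>: "\<psi> \<in> formulas C {0::nat} ?B" "\<And>u. holds C u \<psi> \<longleftrightarrow>
          (\<exists>t. (\<forall>j\<in>J - {i}. t j = val j) \<and> t i = u 0 \<and> (\<forall>\<phi>\<in>F. holds C t \<phi>))"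
        using projection_formula[OF F(1) \<open>F \<subseteq> formulas C I A\<close>, where m = val and J = J and i = i]
        by blast
      have "J - {i} = J" using \<open>i \<notin> J\<close> by blast
      then have "holds C u \<psi> \<longleftrightarrow> good F (u 0)" for u using \<psi>(2) by (simp add: good_def)
      moreover then have "\<psi> \<in> p" using \<psi>(1) F unfolding p_def by blast
      ultimately show ?thesis using u q(2) by blast
    qed
    have u_ext: "\<exists>t. (\<forall>(j, x)\<in>insert (i, u 0) m. t j = x) \<and> (\<forall>\<phi>\<in>F. holds C t \<phi>)"
      if F: "finite F" "F \<subseteq> \<Phi>" for F
    proof -
      obtain t where "\<forall>j\<in>J. t j = val j" "t i = u 0" "\<forall>\<phi>\<in>F. holds C t \<phi>"
        using u_good[OF F] unfolding good_def by blast
      then show ?thesis using m_val[of t] by (intro exI[of _ t]) simp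
    qed
    have "insert (i, u 0) m \<subseteq> I \<times> UNIV" using m i by (auto simp: \<A>_def)
    then have "insert (i, u 0) m \<in> \<A>"
      unfolding \<A>_def using u_ext by (intro CollectI conjI allI impI) (simp_all only:)
    then have "(i, u 0) \<in> m" using max by blast
    then show False using \<open>i \<notin> J\<close> by (force simp: J_def)
  qed
  then have "J = I" using J by blast
  have "holds C val \<phi>" if \<phi>: "\<phi> \<in> \<Phi>" for \<phi>
  proof -
    obtain t where "\<forall>j\<in>J. t j = val j" "holds C t \<phi>" using ext[of "{\<phi>}"] \<phi> by auto
    then show ?thesis using holds_cong[of \<phi> C I A val t] \<phi> \<Phi>(1) \<open>J = I\<close> by auto
  qed
  then show thesis using that by blast
qed

lemma small_enumeration:
  assumes "Card_order \<kappa>" "|I| <o \<kappa>"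
  obtains \<beta> h where "\<beta> \<in> Field \<kappa>" "bij_betw h (underS \<kappa> \<beta>) I"
proof -
  have W: "Well_order \<kappa>" using assms(1) by (simp add: card_order_on_def)
  then obtain \<beta> where \<beta>: "\<beta> \<in> Field \<kappa>" "|I| =o Restr \<kappa> (underS \<kappa> \<beta>)"
    using ordLess_iff_ordIso_Restr[of \<kappa> "|I|"] card_of_Well_order assms(2) by blast
  have "Field (Restr \<kappa> (underS \<kappa> \<beta>)) = underS \<kappa> \<beta>"
    using W by (simp add: Field_Restr_ofilter wo_rel.underS_ofilter wo_rel_def)
  then have "\<exists>h. bij_betw h I (underS \<kappa> \<beta>)"
    using \<beta>(2) unfolding ordIso_def BNF_Wellorder_Embedding.iso_def by (auto simp: Field_card_of)
  then show thesis using that \<beta>(1) bij_betw_inv by blast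
qed

text \<open>
  Strong homogeneity, freed from ordinals as index sets and extended to types over a small set
  (whose elements are adjoined to the tuple).
\<close>
lemma homogeneous:
  fixes C :: "('f, 'r, 'a) fo_structure" and \<kappa> :: "'k rel" and s t :: "'i \<Rightarrow> 'a"
  assumes "strongly_homogeneous C \<kappa>" and \<kappa>: "Card_order \<kappa>" "natLeq <o \<kappa>"
    and inf: "infinite (UNIV :: 'i set)" and I: "|I| <o \<kappa>" and A: "|A| <o \<kappa>"
    and eq: "tp C I s A = tp C I t A"
  obtains f where "f \<in> aut C" "\<And>i. i \<in> I \<Longrightarrow> f (s i) = t i" "\<And>x. x \<in> A \<Longrightarrow> f x = x"
proof -
  obtain \<beta> h where \<beta>: "\<beta> \<in> Field \<kappa>" "bij_betw h (underS \<kappa> \<beta>) (I <+> A)"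
    using small_enumeration[OF \<kappa>(1) small_Plus[OF \<kappa> I A]] by blast
  let ?\<beta> = "underS \<kappa> \<beta>"
  have h: "h j \<in> I <+> A" if "j \<in> ?\<beta>" for j using that \<beta>(2) bij_betwE by blast
  define ext where "ext u = restrict (case_sum u id \<circ> h) ?\<beta>" for u :: "'i \<Rightarrow> 'a"
  have ext: "ext u \<in> tuples \<kappa> \<beta> UNIV" for u by (auto simp: ext_def tuples_def)
  have "\<phi> \<in> tp C ?\<beta> (ext s) {} \<longleftrightarrow> \<phi> \<in> tp C ?\<beta> (ext t) {}" if \<phi>: "\<phi> \<in> formulas C ?\<beta> {}"
    for \<phi> :: "('f, 'r, 'k + 'a) form"
  proof -
    define \<tau> where "\<tau> = case_sum h (Inr :: 'a \<Rightarrow> 'i + 'a)"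
    have "\<tau> ` (?\<beta> <+> {}) \<subseteq> I <+> A" using h by (auto simp: \<tau>_def)
    then obtain \<psi> where \<psi>: "\<psi> \<in> formulas C I A"
      "\<And>u. holds C u \<psi> \<longleftrightarrow> sat C UNIV (case_sum u id \<circ> \<tau>) \<phi>"
      using rename_formula[OF inf \<phi>, of \<tau> I A] by blast
    have "holds C (ext u) \<phi> \<longleftrightarrow> holds C u \<psi>" for u
      unfolding \<psi>(2) unfolding holds_def using \<phi>
      by (intro sat_cong) (auto simp: formulas_def ext_def \<tau>_def)
    moreover have "holds C s \<psi> \<longleftrightarrow> holds C t \<psi>"
      using eq \<psi>(1) unfolding tp_def by blast
    ultimately show ?thesis by (simp add: tp_def)
  qed
  then have "tp C ?\<beta> (ext s) {} = tp C ?\<beta> (ext t) {}" by (auto simp: tp_def)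
  then obtain f where f: "f \<in> aut C" "compose ?\<beta> f (ext s) = ext t"
    using assms(1) \<beta>(1) ext unfolding strongly_homogeneous_def by meson
  have f_ext: "f (case_sum s id y) = case_sum t id y" if "y \<in> I <+> A" for y
  proof -
    have "y \<in> h ` ?\<beta>" using that \<beta>(2) by (simp add: bij_betw_def)
    then obtain j where "j \<in> ?\<beta>" "y = h j" by blast
    then show ?thesis using fun_cong[OF f(2), of j] by (simp add: compose_def ext_def)
  qed
  show thesis
  proof (rule that[OF f(1)])
    show "f (s i) = t i" if "i \<in> I" for i using f_ext[of "Inl i"] that by auto
    show "f x = x" if "x \<in> A" for x using f_ext[of "Inr x"] that by auto
  qed
qed


section \<open>Topological groups as quotients of compact spaces\<close>

lemma topspace_quotient_topology:
  assumes "f ` topspace X \<subseteq> Y"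
  shows "topspace (quotient_topology X Y f) = Y"
proof -
  have "{x \<in> topspace X. f x \<in> Y} = topspace X" using assms by blast
  then have "openin (quotient_topology X Y f) Y" by (simp add: openin_quotient_topology)
  then show ?thesis
    using openin_quotient_topology openin_subset openin_topspace by (metis subset_antisym)
qed

lemma closedin_quotient_topology:
  assumes "f ` topspace X \<subseteq> Y"
  shows "closedin (quotient_topology X Y f) F \<longleftrightarrow> F \<subseteq> Y \<and> closedin X {x \<in> topspace X. f x \<in> F}"
proof -
  have "{x \<in> topspace X. f x \<in> Y - F} = topspace X - {x \<in> topspace X. f x \<in> F}"
    using assms by blast
  then show ?thesis
    by (auto simp: closedin_def openin_quotient_topology topspace_quotient_topology[OF assms])
qed

lemma continuous_map_quotient_topology:
  assumes "f ` topspace X \<subseteq> Y"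
  shows "continuous_map X (quotient_topology X Y f) f"
  using assms
  by (auto simp: continuous_map_def topspace_quotient_topology openin_quotient_topology)

text \<open>
  The quotient may fail to be Hausdorff, so let \<open>N\<close> be the closure of the identity. Translations and inversion
  are continuous by slicing the hypothesis, whence closed sets are unions of cosets of \<open>N\<close>. To separate
  \<open>(a, b)\<close> from the closed set of pairs with \<open>x\<^sup>-\<^sup>1y \<in> F\<close>, apply Wallace's theorem upstairs to
  the compact preimages of \<open>aN\<close> and \<open>bN\<close>. The neighbourhoods obtained there descend to the quotient because
  saturating a closed set with respect to the cosets of \<open>N\<close> gives a closed set, by projection along a compact factor.
\<close>
lemma topological_group_quotient:
  fixes G (structure)
  assumes "group G" and comp: "compact_space X" and \<nu>: "\<nu> ` topspace X = carrier G"
    and division: "\<And>F. closedin (quotient_topology X (carrier G) \<nu>) F \<Longrightarrow>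
      closedin (prod_topology X X) {(p, r). p \<in> topspace X \<and> r \<in> topspace X \<and> inv (\<nu> p) \<otimes> \<nu> r \<in> F}"
  shows "topological_group G (quotient_topology X (carrier G) \<nu>)"
proof -
  interpret group G by fact
  define Q where "Q = quotient_topology X (carrier G) \<nu>"
  have \<nu>_in: "\<nu> p \<in> carrier G" if "p \<in> topspace X" for p using \<nu> that by blast
  have \<nu>_onto: "\<exists>p\<in>topspace X. \<nu> p = g" if "g \<in> carrier G" for g
  proof -
    have "g \<in> \<nu> ` topspace X" using that \<nu> by simp
    then show ?thesis by blast
  qed
  have topQ: "topspace Q = carrier G"
    using \<nu> by (simp add: Q_def topspace_quotient_topology)
  have closedQ: "closedin Q F \<longleftrightarrow> F \<subseteq> carrier G \<and> closedin X {p \<in> topspace X. \<nu> p \<in> F}" for F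
    using \<nu> by (simp add: Q_def closedin_quotient_topology)
  have division: "closedin (prod_topology X X) {(p, r). p \<in> topspace X \<and> r \<in> topspace X \<and> inv (\<nu> p) \<otimes> \<nu> r \<in> F}"
    if "closedin Q F" for F using division that by (simp add: Q_def)

  have right_slice: "closedin Q {y \<in> carrier G. inv g \<otimes> y \<in> F}" if F: "closedin Q F" and g: "g \<in> carrier G" for F g
  proof -
    obtain p where p: "p \<in> topspace X" "\<nu> p = g" using \<nu>_onto[OF g] by blast
    have "continuous_map X (prod_topology X X) (\<lambda>r. (p, r))"
      using p by (intro continuous_intros) auto
    from closedin_continuous_map_preimage[OF this division[OF F]]
    have "closedin X {r \<in> topspace X. inv g \<otimes> \<nu> r \<in> F}"
      using p by (simp cong: conj_cong)
    moreover have "{p \<in> topspace X. \<nu> p \<in> {y \<in> carrier G. inv g \<otimes> y \<in> F}} = {r \<in> topspace X. inv g \<otimes> \<nu> r \<in> F}"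
      using \<nu>_in by auto
    ultimately show ?thesis by (simp add: closedQ)
  qed
  have left_slice: "closedin Q {y \<in> carrier G. inv y \<otimes> g \<in> F}" if F: "closedin Q F" and g: "g \<in> carrier G" for F g
  proof -
    obtain p where p: "p \<in> topspace X" "\<nu> p = g" using \<nu>_onto[OF g] by blast
    have "continuous_map X (prod_topology X X) (\<lambda>r. (r, p))"
      using p by (intro continuous_intros) auto
    from closedin_continuous_map_preimage[OF this division[OF F]]
    have "closedin X {r \<in> topspace X. inv (\<nu> r) \<otimes> g \<in> F}"
      using p by (simp cong: conj_cong)
    moreover have "{p \<in> topspace X. \<nu> p \<in> {y \<in> carrier G. inv y \<otimes> g \<in> F}} = {r \<in> topspace X. inv (\<nu> r) \<otimes> g \<in> F}"
      using \<nu>_in by auto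
    ultimately show ?thesis by (simp add: closedQ)
  qed
  have inv_closed': "closedin Q {y \<in> carrier G. inv y \<in> F}" if F: "closedin Q F" for F
  proof -
    have "{y \<in> carrier G. inv y \<otimes> \<one> \<in> F} = {y \<in> carrier G. inv y \<in> F}" by auto
    then show ?thesis using left_slice[OF F one_closed] by simp
  qed
  have left_mult: "closedin Q {y \<in> carrier G. g \<otimes> y \<in> F}" if "closedin Q F" "g \<in> carrier G" for F g
    using right_slice[of F "inv g"] that by simp
  have right_mult: "closedin Q {y \<in> carrier G. y \<otimes> g \<in> F}" if "closedin Q F" "g \<in> carrier G" for F g
  proof -
    have "{y \<in> carrier G. inv y \<in> {y \<in> carrier G. inv y \<otimes> g \<in> F}} = {y \<in> carrier G. y \<otimes> g \<in> F}" by auto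
    then show ?thesis using inv_closed'[OF left_slice[OF that]] by simp
  qed

  define N where "N = \<Inter>{F. closedin Q F \<and> \<one> \<in> F}"
  have N_min: "N \<subseteq> F" if "closedin Q F" "\<one> \<in> F" for F using that by (auto simp: N_def)
  have carrier_closed: "closedin Q (carrier G)" using closedin_topspace topQ by metis
  have N_closed: "closedin Q N"
    unfolding N_def by (rule closedin_Inter) (use carrier_closed in auto)
  have N_carrier: "N \<subseteq> carrier G" using N_closed closedQ by blast
  have N_one: "\<one> \<in> N" by (auto simp: N_def)
  have N_inv: "inv n \<in> N" if "n \<in> N" for n
    using N_min[OF inv_closed'[OF N_closed]] that N_one by auto
  have N_right: "f \<otimes> n \<in> F" if "closedin Q F" "f \<in> F" "n \<in> N" for F f n
  proof -
    have "f \<in> carrier G" using that closedQ by blast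
    then show ?thesis using N_min[OF left_mult[OF that(1)], of f] that by auto
  qed
  have N_left: "n \<otimes> f \<in> F" if "closedin Q F" "f \<in> F" "n \<in> N" for F f n
  proof -
    have "f \<in> carrier G" using that closedQ by blast
    then show ?thesis using N_min[OF right_mult[OF that(1)], of f] that by auto
  qed

  have saturation_closed: "closedin Q {y \<in> carrier G. \<exists>p\<in>D. inv (\<nu> p) \<otimes> y \<in> N}" if D: "closedin X D" for D
  proof -
    let ?R = "{(p, r). p \<in> topspace X \<and> r \<in> topspace X \<and> inv (\<nu> p) \<otimes> \<nu> r \<in> N} \<inter> D \<times> topspace X"
    have D_sub: "D \<subseteq> topspace X" using D closedin_subset by blast
    have "closedin (prod_topology X X) ?R"
      using D by (intro closedin_Int division N_closed) (simp add: closedin_prod_Times_iff)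
    then have "closedin X (snd ` ?R)"
      using closed_map_snd[OF comp] unfolding closed_map_def by blast
    moreover have "snd ` ?R = {r \<in> topspace X. \<nu> r \<in> {y \<in> carrier G. \<exists>p\<in>D. inv (\<nu> p) \<otimes> y \<in> N}}"
      (is "_ = ?S")
    proof (intro subset_antisym subsetI)
      fix r assume "r \<in> snd ` ?R"
      then obtain z where "r = snd z" "z \<in> ?R" by (rule imageE)
      then show "r \<in> ?S" using \<nu>_in[of r] by (cases z) auto
    next
      fix r assume "r \<in> ?S"
      then obtain p where "p \<in> D" "r \<in> topspace X" "inv (\<nu> p) \<otimes> \<nu> r \<in> N" by blast
      then have "(p, r) \<in> ?R" using D_sub by blast
      then show "r \<in> snd ` ?R" by (rule image_eqI[rotated]) simp
    qed
    ultimately show ?thesis by (simp add: closedQ)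
  qed

  have div_cont: "continuous_map (prod_topology Q Q) Q (\<lambda>(x, y). inv x \<otimes> y)"
    unfolding continuous_map_def
  proof (intro conjI allI impI)
    show "(\<lambda>(x, y). inv x \<otimes> y) \<in> topspace (prod_topology Q Q) \<rightarrow> topspace Q" by (auto simp: topQ)
    fix U assume U: "openin Q U"
    define F where "F = carrier G - U"
    have F: "closedin Q F" using U openin_closedin_eq[of Q U] by (simp add: F_def topQ)
    have "\<exists>V1 V2. openin Q V1 \<and> openin Q V2 \<and> a \<in> V1 \<and> b \<in> V2 \<and>
        V1 \<times> V2 \<subseteq> {z \<in> topspace (prod_topology Q Q). (case z of (x, y) \<Rightarrow> inv x \<otimes> y) \<in> U}"
      if ab: "a \<in> carrier G" "b \<in> carrier G" "inv a \<otimes> b \<in> U" for a b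
    proof -
      define A where "A c = {p \<in> topspace X. inv c \<otimes> \<nu> p \<in> N}" for c
      have A_compact: "compactin X (A c)" if c: "c \<in> carrier G" for c
      proof -
        have "{p \<in> topspace X. \<nu> p \<in> {y \<in> carrier G. inv c \<otimes> y \<in> N}} = A c"
          using \<nu>_in by (auto simp: A_def)
        then have "closedin X (A c)" using right_slice[OF N_closed c] by (simp add: closedQ)
        then show ?thesis using comp closedin_compact_space by blast
      qed
      define W where "W = topspace X \<times> topspace X - {(p, r). p \<in> topspace X \<and> r \<in> topspace X \<and> inv (\<nu> p) \<otimes> \<nu> r \<in> F}"
      have W: "openin (prod_topology X X) W"
        using division[OF F] by (simp add: W_def closedin_def)
      have sub: "A a \<times> A b \<subseteq> W"
      proof safe
        fix p r assume p: "p \<in> A a" and r: "r \<in> A b"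
        have in_G: "\<nu> p \<in> carrier G" "\<nu> r \<in> carrier G" using p r \<nu>_in by (auto simp: A_def)
        have "inv (\<nu> p) \<otimes> \<nu> r \<notin> F"
        proof
          assume "inv (\<nu> p) \<otimes> \<nu> r \<in> F"
          moreover have "inv a \<otimes> \<nu> p \<in> N" "inv (inv b \<otimes> \<nu> r) \<in> N" using p r N_inv by (auto simp: A_def)
          ultimately have "(inv a \<otimes> \<nu> p) \<otimes> (inv (\<nu> p) \<otimes> \<nu> r) \<otimes> inv (inv b \<otimes> \<nu> r) \<in> F"
            using N_left[OF F] N_right[OF F] by blast
          moreover have "(inv a \<otimes> \<nu> p) \<otimes> (inv (\<nu> p) \<otimes> \<nu> r) \<otimes> inv (inv b \<otimes> \<nu> r) = inv a \<otimes> b"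
          proof -
            have "(inv a \<otimes> \<nu> p) \<otimes> (inv (\<nu> p) \<otimes> \<nu> r) = inv a \<otimes> ((\<nu> p \<otimes> inv (\<nu> p)) \<otimes> \<nu> r)"
              using in_G ab by (simp only: m_assoc inv_closed m_closed)
            also have "\<dots> = inv a \<otimes> \<nu> r" using in_G ab by simp
            finally have "(inv a \<otimes> \<nu> p) \<otimes> (inv (\<nu> p) \<otimes> \<nu> r) \<otimes> inv (inv b \<otimes> \<nu> r)
                = inv a \<otimes> \<nu> r \<otimes> (inv (\<nu> r) \<otimes> b)" using in_G ab by (simp add: inv_mult_group)
            also have "\<dots> = inv a \<otimes> ((\<nu> r \<otimes> inv (\<nu> r)) \<otimes> b)" using in_G ab by (simp only: m_assoc inv_closed m_closed)
            finally show ?thesis using in_G ab by simp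
          qed
          ultimately show False using ab by (simp add: F_def)
        qed
        then show "(p, r) \<in> W" using p r by (auto simp: W_def A_def)
      qed
      obtain O1 O2 where O: "openin X O1" "openin X O2" "A a \<subseteq> O1" "A b \<subseteq> O2" "O1 \<times> O2 \<subseteq> W"
        using Wallace_theorem_prod_topology[OF A_compact[OF ab(1)] A_compact[OF ab(2)] W sub] by metis
      \<comment> \<open>The points of the quotient whose whole coset of \<open>N\<close> has its preimage inside \<open>D\<close>.\<close>
      define V where "V D = carrier G - {y \<in> carrier G. \<exists>p\<in>topspace X - D. inv (\<nu> p) \<otimes> y \<in> N}" for D
      have V_open: "openin Q (V D)" if "openin X D" for D
        using saturation_closed[of "topspace X - D"] that by (simp add: V_def closedin_def topQ openin_subset double_diff)
      have V_mem: "c \<in> V D" if "A c \<subseteq> D" "c \<in> carrier G" for c D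
      proof -
        have "p \<in> D" if p: "p \<in> topspace X" "inv (\<nu> p) \<otimes> c \<in> N" for p
        proof -
          have "inv (inv (\<nu> p) \<otimes> c) = inv c \<otimes> \<nu> p"
            using p \<nu>_in \<open>c \<in> carrier G\<close> by (simp add: inv_mult_group)
          then have "p \<in> A c" using N_inv[OF p(2)] p(1) by (simp add: A_def)
          then show ?thesis using \<open>A c \<subseteq> D\<close> by blast
        qed
        then show ?thesis using \<open>c \<in> carrier G\<close> by (auto simp: V_def)
      qed
      have V_sub: "p \<in> D" if "\<nu> p \<in> V D" "p \<in> topspace X" for p D
      proof (rule ccontr)
        assume "p \<notin> D"
        moreover have "inv (\<nu> p) \<otimes> \<nu> p \<in> N" using that(2) N_one \<nu>_in by simp
        ultimately show False using that unfolding V_def by blast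
      qed
      have "inv x \<otimes> y \<in> U" if xy: "x \<in> V O1" "y \<in> V O2" for x y
      proof -
        have "x \<in> carrier G" "y \<in> carrier G" using xy by (auto simp: V_def)
        then obtain p r where pr: "p \<in> topspace X" "\<nu> p = x" "r \<in> topspace X" "\<nu> r = y"
          using \<nu>_onto by metis
        then have "(p, r) \<in> W" using V_sub[of p O1] V_sub[of r O2] xy O(5) by blast
        then have "inv x \<otimes> y \<notin> F" using pr by (auto simp: W_def)
        then show ?thesis using \<open>x \<in> carrier G\<close> \<open>y \<in> carrier G\<close> by (simp add: F_def)
      qed
      moreover have "V O1 \<subseteq> carrier G" "V O2 \<subseteq> carrier G" by (auto simp: V_def)
      ultimately have "V O1 \<times> V O2 \<subseteq> {z \<in> topspace (prod_topology Q Q). (case z of (x, y) \<Rightarrow> inv x \<otimes> y) \<in> U}"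
        by (auto simp: topQ)
      then show ?thesis using V_open O V_mem ab by meson
    qed
    then show "openin (prod_topology Q Q) {z \<in> topspace (prod_topology Q Q). (case z of (x, y) \<Rightarrow> inv x \<otimes> y) \<in> U}"
      unfolding openin_prod_topology_alt by (auto simp: topQ)
  qed
  have inv_cont: "continuous_map Q Q (\<lambda>x. inv x)"
    unfolding continuous_map_closedin using inv_closed' by (auto simp: topQ)
  have "continuous_map (prod_topology Q Q) (prod_topology Q Q) (\<lambda>z. (inv (fst z), snd z))"
    by (intro continuous_map_pairedI continuous_map_compose[OF continuous_map_fst inv_cont, unfolded o_def] continuous_map_snd)
  from continuous_map_compose[OF this div_cont]
  have "continuous_map (prod_topology Q Q) Q (\<lambda>z. inv (inv (fst z)) \<otimes> snd z)" by (simp add: o_def)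
  then have "continuous_map (prod_topology Q Q) Q (\<lambda>(x, y). x \<otimes> y)"
    by (rule continuous_map_eq) (auto simp: topQ)
  then show ?thesis
    using inv_cont topQ group_axioms unfolding topological_group_def Q_def by blast
qed


section \<open>Automorphisms\<close>

lemma aut_id: "id \<in> aut C"
  by (simp add: aut_def)

lemma aut_comp: "f \<in> aut C \<Longrightarrow> g \<in> aut C \<Longrightarrow> f \<circ> g \<in> aut C"
  unfolding aut_def
  by (fastforce intro: bij_comp simp: map_map[symmetric] simp del: map_map)

lemma aut_inv:
  assumes f: "f \<in> aut C" shows "inv_into UNIV f \<in> aut C"
proof -
  let ?g = "inv_into UNIV f"
  have bij: "bij f" using f by (simp add: aut_def)
  then have fg: "f (?g x) = x" and gf: "?g (f x) = x" for x
    by (simp_all add: bij_is_surj surj_f_inv_f bij_is_inj)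
  have map_fg: "map f (map ?g xs) = xs" for xs by (simp add: fg o_def)
  have "?g (fun_int C h xs) = fun_int C h (map ?g xs)" if "(h, length xs) \<in> funs C" for h xs
  proof -
    have "f (fun_int C h (map ?g xs)) = fun_int C h xs"
      using aut_fun_int[OF f, of h "map ?g xs"] that map_fg[of xs] by simp
    then show ?thesis using gf by metis
  qed
  moreover have "rel_int C r (map ?g xs) = rel_int C r xs" if "(r, length xs) \<in> rels C" for r xs
    using aut_rel_int[OF f, of r "map ?g xs"] that map_fg[of xs] by simp
  ultimately show ?thesis
    using bij_imp_bij_inv[OF bij] unfolding aut_def by blast
qed

lemma aut_inv_apply:
  assumes "f \<in> aut C" shows "f (inv_into UNIV f x) = x" and "inv_into UNIV f (f x) = x"
  using assms by (simp_all add: aut_def bij_is_surj surj_f_inv_f bij_is_inj)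

lemma elementary_substructure_aut:
  fixes C :: "('f, 'r, 'a) fo_structure"
  assumes f: "f \<in> aut C" and M: "elementary_substructure C M"
  shows "elementary_substructure C (f ` M)"
proof -
  let ?g = "inv_into UNIV f"
  note fg = aut_inv_apply[OF f]
  have g_in: "?g x \<in> M" if "x \<in> f ` M" for x using that fg by auto
  have "fun_int C h xs \<in> f ` M" if "(h, length xs) \<in> funs C" "set xs \<subseteq> f ` M" for h xs
  proof -
    have "set (map ?g xs) \<subseteq> M" using that(2) g_in by auto
    then have "fun_int C h (map ?g xs) \<in> M"
      using M that(1) unfolding elementary_substructure_def by fastforce
    moreover have "f (fun_int C h (map ?g xs)) = fun_int C h xs"
      using aut_fun_int[OF f, of h "map ?g xs"] that(1) fg by (simp add: o_def)
    ultimately show ?thesis by (metis imageI)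
  qed
  moreover have "sat C (f ` M) v \<phi> \<longleftrightarrow> sat C UNIV v \<phi>" if "wf_form C \<phi>" "range v \<subseteq> f ` M"
    for v and \<phi> :: "('f, 'r, nat) form"
  proof -
    have v: "f \<circ> (?g \<circ> v) = v" using fg by (simp add: fun_eq_iff)
    have "range (?g \<circ> v) \<subseteq> M" using that(2) g_in by auto
    then have "sat C M (?g \<circ> v) \<phi> \<longleftrightarrow> sat C UNIV (?g \<circ> v) \<phi>"
      using M that(1) unfolding elementary_substructure_def by blast
    then show ?thesis
      using sat_aut[OF f that(1), of M "?g \<circ> v"] sat_UNIV_aut[OF f that(1), of "?g \<circ> v"]
      unfolding v by blast
  qed
  ultimately show ?thesis using M unfolding elementary_substructure_def by blast
qed

lemma compose_compose: "compose A (f \<circ> g) t = compose A f (compose A g t)"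
  by (auto simp: compose_def)

lemma compose_extensional_id: "t \<in> extensional A \<Longrightarrow> compose A id t = t"
  by (auto simp: compose_def extensional_def)

locale galois_setting =
  fixes C :: "('f, 'r, 'a) fo_structure" and T :: "('f, 'r, nat) form set" and \<kappa> :: "'k rel"
    and \<alpha> \<eta> :: 'k and e :: "('k \<Rightarrow> 'a) set" and \<Sigma> :: "('f, 'r, 'k + 'a) form set"
  assumes monster: "monster_model C T \<kappa>"
    and hyper: "hyperimaginary C \<kappa> \<alpha> e"
    and ptype: "partial_type C \<kappa> \<eta> \<Sigma>"
    and invariant: "e_invariant C \<kappa> \<alpha> e \<eta> \<Sigma>"
begin

abbreviation G where "G \<equiv> aut_e C \<kappa> \<alpha> e"
abbreviation L where "L \<equiv> autf_L C \<kappa> \<alpha> e"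
abbreviation sol where "sol \<equiv> solutions C \<kappa> \<eta> \<Sigma>"
abbreviation SG where "SG \<equiv> aut_sol_group C \<kappa> \<alpha> e \<eta> \<Sigma>"
abbreviation N where "N \<equiv> autf_sol C \<kappa> \<alpha> e \<eta> \<Sigma>"
abbreviation Gal where "Gal \<equiv> Gal_L C \<kappa> \<alpha> e \<eta> \<Sigma>"

lemma card_order: "Card_order \<kappa>" and uncountable: "natLeq <o \<kappa>"
  and saturated: "saturated C \<kappa>" and strongly_homogeneous: "strongly_homogeneous C \<kappa>"
  using monster by (auto simp: monster_model_def)

lemma e_tuples: "e \<subseteq> extensional (underS \<kappa> \<alpha>)"
proof -
  obtain E where E: "equiv (tuples \<kappa> \<alpha> UNIV) E" "e \<in> tuples \<kappa> \<alpha> (UNIV :: 'a set) // E"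
    using hyper unfolding hyperimaginary_def by blast
  then have "e \<subseteq> tuples \<kappa> \<alpha> UNIV" using in_quotient_imp_subset by blast
  then show ?thesis by (auto simp: tuples_def PiE_def)
qed

lemma G_aut: "f \<in> G \<Longrightarrow> f \<in> aut C"
  by (simp add: aut_e_def)

lemma compose_id_image: "compose (underS \<kappa> \<alpha>) id ` e = e"
proof -
  have "compose (underS \<kappa> \<alpha>) id ` e = (\<lambda>t. t) ` e"
    using e_tuples by (intro image_cong refl compose_extensional_id) auto
  then show ?thesis by simp
qed

lemma G_id: "id \<in> G"
  using compose_id_image by (simp add: aut_e_def aut_id)

lemma compose_comp_image:
  "compose I (f \<circ> g) ` S = compose I f ` (compose I g ` S)"
  by (simp add: image_image compose_compose)

lemma G_comp: "f \<in> G \<Longrightarrow> g \<in> G \<Longrightarrow> f \<circ> g \<in> G"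
  by (simp add: aut_e_def aut_comp compose_comp_image)

lemma G_inv: "f \<in> G \<Longrightarrow> inv_into UNIV f \<in> G"
proof -
  assume f: "f \<in> G"
  have "inv_into UNIV f \<circ> f = id" using aut_inv_apply[OF G_aut[OF f]] by auto
  then have "compose (underS \<kappa> \<alpha>) (inv_into UNIV f) ` (compose (underS \<kappa> \<alpha>) f ` e) = e"
    using compose_comp_image[of "underS \<kappa> \<alpha>" "inv_into UNIV f" f e] compose_id_image by simp
  then show ?thesis using f by (simp add: aut_e_def aut_inv)
qed

lemma G_inv_apply:
  assumes "f \<in> G" shows "f (inv_into UNIV f x) = x" and "inv_into UNIV f (f x) = x"
  by (fact aut_inv_apply[OF G_aut[OF assms]])+

abbreviation AG where "AG \<equiv> BijGroup (UNIV :: 'a set)\<lparr>carrier := G\<rparr>"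

lemma G_Bij: "f \<in> G \<Longrightarrow> f \<in> Bij UNIV"
  by (simp add: aut_e_def aut_def Bij_def)

lemma AG_mult: "f \<in> G \<Longrightarrow> g \<in> G \<Longrightarrow> f \<otimes>\<^bsub>AG\<^esub> g = f \<circ> g"
  by (simp add: BijGroup_def G_Bij compose_def o_def restrict_UNIV)

lemma AG_one: "\<one>\<^bsub>AG\<^esub> = id"
  by (auto simp: BijGroup_def)

lemma G_subgroup: "subgroup G (BijGroup UNIV)"
proof (rule group.subgroupI[OF group_BijGroup])
  show "G \<subseteq> carrier (BijGroup UNIV)" using G_Bij by (auto simp: BijGroup_def)
  show "G \<noteq> {}" using G_id by blast
  show "inv\<^bsub>BijGroup UNIV\<^esub> f \<in> G" if "f \<in> G" for f
    using that inv_BijGroup[OF G_Bij[OF that]] G_inv by (simp add: restrict_UNIV)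
  show "f \<otimes>\<^bsub>BijGroup UNIV\<^esub> g \<in> G" if "f \<in> G" "g \<in> G" for f g
    using that AG_mult[OF that] G_comp by simp
qed

lemma AG_group: "group AG"
  using G_subgroup group_BijGroup by (rule subgroup.subgroup_is_group)

lemma AG_inv: "f \<in> G \<Longrightarrow> inv\<^bsub>AG\<^esub> f = inv_into UNIV f"
  using group.m_inv_consistent[OF group_BijGroup G_subgroup] inv_BijGroup[OF G_Bij]
  by (simp add: restrict_UNIV)

lemma in_dcl_aut:
  assumes g: "g \<in> G" and B: "in_dcl C \<kappa> \<alpha> e B" shows "in_dcl C \<kappa> \<alpha> e (g ` B)"
  unfolding in_dcl_def
proof (intro ballI impI)
  fix f assume f: "f \<in> aut C" "\<forall>x\<in>g ` B. f x = x"
  let ?h = "inv_into UNIV g \<circ> f \<circ> g"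
  have "?h \<in> aut C" using f(1) G_aut G_inv g aut_comp by meson
  moreover have "\<forall>x\<in>B. ?h x = x" using f(2) G_inv_apply[OF g] by simp
  ultimately have "?h \<in> G" using B unfolding in_dcl_def by blast
  then have "g \<circ> ?h \<circ> inv_into UNIV g \<in> G" using g G_inv G_comp by blast
  moreover have "g \<circ> ?h \<circ> inv_into UNIV g = f" using G_inv_apply[OF g] by (auto simp: fun_eq_iff)
  ultimately show "f \<in> G" by simp
qed

definition fixing_model :: "('a \<Rightarrow> 'a) set" where
  "fixing_model = {f \<in> G. \<exists>M. |M| <o \<kappa> \<and> elementary_substructure C M \<and>
     in_dcl C \<kappa> \<alpha> e M \<and> (\<forall>x\<in>M. f x = x)}"

lemma L_eq: "L = generate AG fixing_model"
  by (simp add: autf_L_def fixing_model_def)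

lemma fixing_model_G: "fixing_model \<subseteq> G"
  by (auto simp: fixing_model_def)

lemma L_subgroup: "subgroup L AG"
  unfolding L_eq using group.generate_is_subgroup[OF AG_group] fixing_model_G by simp

lemma L_G: "f \<in> L \<Longrightarrow> f \<in> G"
  using subgroup.mem_carrier[OF L_subgroup] by simp

lemma L_id: "id \<in> L"
  using subgroup.one_closed[OF L_subgroup] by (simp add: AG_one)

lemma L_comp: "f \<in> L \<Longrightarrow> g \<in> L \<Longrightarrow> f \<circ> g \<in> L"
  using subgroup.m_closed[OF L_subgroup] AG_mult L_G by metis

lemma L_inv: "f \<in> L \<Longrightarrow> inv_into UNIV f \<in> L"
  using subgroup.m_inv_closed[OF L_subgroup] AG_inv L_G by metis

lemma fixing_model_conj:
  assumes g: "g \<in> G" and h: "h \<in> fixing_model"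
  shows "g \<circ> h \<circ> inv_into UNIV g \<in> fixing_model"
proof -
  obtain M where M: "|M| <o \<kappa>" "elementary_substructure C M" "in_dcl C \<kappa> \<alpha> e M" "\<forall>x\<in>M. h x = x" and hG: "h \<in> G"
    using h by (auto simp: fixing_model_def)
  have "|g ` M| <o \<kappa>" using M(1) by (rule small_image)
  moreover have "elementary_substructure C (g ` M)" using elementary_substructure_aut G_aut g M(2) by blast
  moreover have "in_dcl C \<kappa> \<alpha> e (g ` M)" using in_dcl_aut g M(3) by blast
  moreover have "\<forall>x\<in>g ` M. (g \<circ> h \<circ> inv_into UNIV g) x = x" using M(4) G_inv_apply[OF g] by auto
  moreover have "g \<circ> h \<circ> inv_into UNIV g \<in> G" using g hG G_inv G_comp by blast
  ultimately show ?thesis unfolding fixing_model_def by blast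
qed

text \<open>Conjugating by \<open>g\<close> turns an automorphism fixing \<open>M\<close> into one fixing \<open>g(M)\<close>.\<close>
lemma L_conj:
  assumes g: "g \<in> G" and h: "h \<in> L"
  shows "g \<circ> h \<circ> inv_into UNIV g \<in> L"
  using h unfolding L_eq
proof (induction rule: generate.induct)
  case one
  have "g \<circ> id \<circ> inv_into UNIV g = id" using G_inv_apply[OF g] by (auto simp: fun_eq_iff)
  then show ?case using generate.one[of AG fixing_model] by (simp only: AG_one)
next
  case (incl h)
  then show ?case by (intro generate.incl fixing_model_conj[OF g])
next
  case (inv h)
  have h: "h \<in> G" using inv fixing_model_G by blast
  let ?k = "g \<circ> h \<circ> inv_into UNIV g"
  have k: "?k \<in> fixing_model" using inv fixing_model_conj[OF g] by blast
  have kG: "?k \<in> G" using k fixing_model_G by blast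
  have "inv_into UNIV ?k x = (g \<circ> inv_into UNIV h \<circ> inv_into UNIV g) x" for x
  proof -
    have "?k ((g \<circ> inv_into UNIV h \<circ> inv_into UNIV g) x) = x"
      using G_inv_apply[OF g] G_inv_apply[OF h] by simp
    then show ?thesis using G_inv_apply(2)[OF kG] by metis
  qed
  then have "inv\<^bsub>AG\<^esub> ?k = g \<circ> inv\<^bsub>AG\<^esub> h \<circ> inv_into UNIV g"
    using AG_inv[OF kG] AG_inv[OF h] by auto
  then show ?case using generate.inv[OF k, of AG] by (simp only:)
next
  case (eng h1 h2)
  have hG: "h1 \<in> G" "h2 \<in> G" using eng L_G by (auto simp: L_eq)
  have "g \<circ> (h1 \<otimes>\<^bsub>AG\<^esub> h2) \<circ> inv_into UNIV g = (g \<circ> h1 \<circ> inv_into UNIV g) \<circ> (g \<circ> h2 \<circ> inv_into UNIV g)"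
    using AG_mult[OF hG] G_inv_apply[OF g] by (auto simp: fun_eq_iff)
  then show ?case using L_comp[unfolded L_eq, OF eng.IH] by (simp only:)
qed


subsection \<open>The Galois group as a quotient of the automorphism group\<close>

definition res :: "('a \<Rightarrow> 'a) \<Rightarrow> ('k \<Rightarrow> 'a) \<Rightarrow> 'k \<Rightarrow> 'a" where
  "res f = restrict (compose (underS \<kappa> \<eta>) f) sol"

lemma aut_sol_eq: "aut_sol C \<kappa> \<alpha> e \<eta> \<Sigma> = res ` G"
  by (simp add: aut_sol_def res_def[abs_def])

lemma sol_tuples: "s \<in> sol \<Longrightarrow> s \<in> tuples \<kappa> \<eta> UNIV"
  by (simp add: solutions_def)

lemma sol_compose: "f \<in> G \<Longrightarrow> s \<in> sol \<Longrightarrow> compose (underS \<kappa> \<eta>) f s \<in> sol"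
  using invariant sol_tuples unfolding e_invariant_def by blast

lemma res_mem: "f \<in> G \<Longrightarrow> s \<in> sol \<Longrightarrow> res f s \<in> sol"
  by (simp add: res_def sol_compose)

lemma res_comp: "g \<in> G \<Longrightarrow> res (f \<circ> g) = compose sol (res f) (res g)"
  by (auto simp: res_def compose_compose compose_def[of sol] sol_compose)

lemma res_id: "res id = (\<lambda>s\<in>sol. s)"
  unfolding res_def
  by (intro restrict_ext compose_extensional_id) (use sol_tuples in \<open>auto simp: tuples_def PiE_def\<close>)

lemma res_inverse:
  assumes "f \<in> G" "s \<in> sol" shows "res (inv_into UNIV f) (res f s) = s" "res f (res (inv_into UNIV f) s) = s"
proof -
  have "inv_into UNIV f \<circ> f = id" "f \<circ> inv_into UNIV f = id"
    using G_inv_apply[OF assms(1)] by (auto simp: fun_eq_iff)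
  then have "compose sol (res (inv_into UNIV f)) (res f) s = (\<lambda>s\<in>sol. s) s"
    "compose sol (res f) (res (inv_into UNIV f)) s = (\<lambda>s\<in>sol. s) s"
    using res_comp[OF assms(1), of "inv_into UNIV f"] res_comp[OF G_inv[OF assms(1)], of f] res_id by simp_all
  then show "res (inv_into UNIV f) (res f s) = s" "res f (res (inv_into UNIV f) s) = s"
    using assms(2) by (simp_all add: compose_def)
qed

lemma res_Bij:
  assumes f: "f \<in> G" shows "res f \<in> Bij sol"
proof -
  have "bij_betw (res f) sol sol"
    by (rule bij_betw_byWitness[where f' = "res (inv_into UNIV f)"])
       (use res_inverse[OF f] res_mem[OF f] res_mem[OF G_inv[OF f]] in auto)
  then show ?thesis by (simp add: Bij_def res_def)
qed

lemma SG_carrier: "carrier SG = res ` G"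
  by (simp add: aut_sol_group_def aut_sol_eq)

lemma SG_mult: "f \<in> G \<Longrightarrow> g \<in> G \<Longrightarrow> res f \<otimes>\<^bsub>SG\<^esub> res g = res (f \<circ> g)"
  by (simp add: aut_sol_group_def BijGroup_def res_Bij res_comp)

lemma SG_one: "\<one>\<^bsub>SG\<^esub> = res id"
  by (simp add: aut_sol_group_def BijGroup_def res_id)

lemma SG_group: "group SG"
proof (rule groupI)
  show "\<one>\<^bsub>SG\<^esub> \<in> carrier SG" using G_id by (simp add: SG_one SG_carrier)
next
  fix x y assume "x \<in> carrier SG" "y \<in> carrier SG"
  then show "x \<otimes>\<^bsub>SG\<^esub> y \<in> carrier SG" using G_comp by (auto simp: SG_carrier SG_mult)
next
  fix x y z assume "x \<in> carrier SG" "y \<in> carrier SG" "z \<in> carrier SG"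
  then show "x \<otimes>\<^bsub>SG\<^esub> y \<otimes>\<^bsub>SG\<^esub> z = x \<otimes>\<^bsub>SG\<^esub> (y \<otimes>\<^bsub>SG\<^esub> z)"
    using G_comp by (auto simp: SG_carrier SG_mult comp_assoc)
next
  fix x assume "x \<in> carrier SG"
  then show "\<one>\<^bsub>SG\<^esub> \<otimes>\<^bsub>SG\<^esub> x = x" using G_id by (auto simp: SG_carrier SG_mult SG_one)
next
  fix x assume "x \<in> carrier SG"
  then obtain f where f: "f \<in> G" "x = res f" by (auto simp: SG_carrier)
  moreover have "inv_into UNIV f \<circ> f = id" using G_inv_apply[OF f(1)] by (auto simp: fun_eq_iff)
  ultimately show "\<exists>y\<in>carrier SG. y \<otimes>\<^bsub>SG\<^esub> x = \<one>\<^bsub>SG\<^esub>"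
    using G_inv by (intro bexI[of _ "res (inv_into UNIV f)"]) (auto simp: SG_carrier SG_mult SG_one)
qed

lemma SG_inv:
  assumes "f \<in> G" shows "inv\<^bsub>SG\<^esub> (res f) = res (inv_into UNIV f)"
proof (rule group.inv_equality[OF SG_group])
  have "inv_into UNIV f \<circ> f = id" using G_inv_apply[OF assms] by (auto simp: fun_eq_iff)
  then show "res (inv_into UNIV f) \<otimes>\<^bsub>SG\<^esub> res f = \<one>\<^bsub>SG\<^esub>" using assms G_inv by (simp add: SG_mult SG_one)
qed (use assms G_inv in \<open>auto simp: SG_carrier\<close>)

text \<open>For a tuple \<open>b\<close> enumerating \<open>B\<close> this says that \<open>b\<close> and \<open>f(b)\<close> have the same Lascar strong type over \<open>e\<close>.\<close>
definition lascar_on :: "('a \<Rightarrow> 'a) \<Rightarrow> 'a set \<Rightarrow> bool" where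
  "lascar_on f B \<longleftrightarrow> (\<exists>h\<in>L. \<forall>x\<in>B. h x = f x)"

lemma lascar_on_fix: "(\<And>x. x \<in> B \<Longrightarrow> f x = x) \<Longrightarrow> lascar_on f B"
  unfolding lascar_on_def by (rule bexI[OF _ L_id]) simp

lemma lascar_on_comp:
  assumes "lascar_on g B" "lascar_on f (g ` B)"
  shows "lascar_on (f \<circ> g) B"
proof -
  obtain h k where "h \<in> L" "\<forall>x\<in>B. h x = g x" "k \<in> L" "\<forall>x\<in>g ` B. k x = f x"
    using assms unfolding lascar_on_def by blast
  then show ?thesis unfolding lascar_on_def by (intro bexI[of _ "k \<circ> h"] L_comp) auto
qed

lemma lascar_on_inv:
  assumes f: "f \<in> G" and "lascar_on f (inv_into UNIV f ` B)"
  shows "lascar_on (inv_into UNIV f) B"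
proof -
  obtain h where h: "h \<in> L" "\<forall>x\<in>inv_into UNIV f ` B. h x = f x"
    using assms(2) unfolding lascar_on_def by blast
  have "inv_into UNIV h x = inv_into UNIV f x" if "x \<in> B" for x
  proof -
    have "h (inv_into UNIV f x) = x" using h(2) that G_inv_apply[OF f] by simp
    then show ?thesis using G_inv_apply(2)[OF L_G[OF h(1)]] by metis
  qed
  then show ?thesis using L_inv[OF h(1)] unfolding lascar_on_def by blast
qed

lemma lascar_on_conj:
  assumes g: "g \<in> G" and "lascar_on f (inv_into UNIV g ` B)"
  shows "lascar_on (g \<circ> f \<circ> inv_into UNIV g) B"
proof -
  obtain h where h: "h \<in> L" "\<forall>x\<in>inv_into UNIV g ` B. h x = f x"
    using assms(2) unfolding lascar_on_def by blast
  then show ?thesis unfolding lascar_on_def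
    by (intro bexI[OF _ L_conj[OF g h(1)]]) auto
qed

lemma tuple_entry:
  assumes "b \<in> tuples \<kappa> l sol" "i \<in> underS \<kappa> l" "j \<in> underS \<kappa> \<eta>"
  shows "compose (underS \<kappa> l) (res f) b i j = f (b i j)"
  using assms by (auto simp: compose_def res_def tuples_def)

lemma tuple_res:
  assumes "f \<in> G" "b \<in> tuples \<kappa> l sol"
  shows "compose (underS \<kappa> l) (res f) b \<in> tuples \<kappa> l sol"
  using assms res_mem by (auto simp: compose_def tuples_def)

lemma entries_res:
  assumes "b \<in> tuples \<kappa> l sol"
  shows "entries \<kappa> l \<eta> (compose (underS \<kappa> l) (res f) b) = f ` entries \<kappa> l \<eta> b"
proof -
  have "entries \<kappa> l \<eta> (compose (underS \<kappa> l) (res f) b) = (\<lambda>z. f (case_prod b z)) ` positions \<kappa> l \<eta>"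
    unfolding entries_def using tuple_entry[OF assms]
    by (intro image_cong refl) (auto simp: positions_def)
  then show ?thesis by (simp add: entries_def image_image)
qed

lemma lascar_fixes_res:
  assumes "b \<in> tuples \<kappa> l sol"
  shows "lascar_fixes C \<kappa> \<alpha> e \<eta> l b (res f) \<longleftrightarrow> lascar_on f (entries \<kappa> l \<eta> b)"
proof -
  have "(\<forall>p\<in>positions \<kappa> l \<eta>. h (case_prod b p) = case_prod (compose (underS \<kappa> l) (res f) b) p) \<longleftrightarrow>
      (\<forall>x\<in>entries \<kappa> l \<eta> b. h x = f x)" for h
    unfolding entries_def using tuple_entry[OF assms, where f = f]
    by (simp add: positions_def)
  then show ?thesis unfolding lascar_fixes_def lascar_equiv_def lascar_on_def by simp
qed

lemma N_iff:
  assumes "f \<in> G"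
  shows "res f \<in> N \<longleftrightarrow> (\<forall>l\<in>Field \<kappa>. \<forall>b\<in>tuples \<kappa> l sol. lascar_on f (entries \<kappa> l \<eta> b))"
  unfolding autf_sol_def using assms lascar_fixes_res by (auto simp: aut_sol_eq)

lemma N_normal: "N \<lhd> SG"
proof -
  have N_sub: "N \<subseteq> res ` G" by (auto simp: autf_sol_def aut_sol_eq)
  \<comment> \<open>If \<open>b\<close> is a tuple of realisations, then so is \<open>g(b)\<close>.\<close>
  have N_image: "lascar_on f (g ` entries \<kappa> l \<eta> b)"
    if "f \<in> G" "res f \<in> N" "g \<in> G" "l \<in> Field \<kappa>" "b \<in> tuples \<kappa> l sol" for f g l b
    using N_iff[OF that(1)] that tuple_res[OF that(3,5)] entries_res[OF that(5), of g] by metis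
  have subgroup: "subgroup N SG"
  proof (rule group.subgroupI[OF SG_group])
    show "N \<subseteq> carrier SG" using N_sub by (simp add: SG_carrier)
    have "res id \<in> N" using G_id lascar_on_fix by (simp add: N_iff)
    then show "N \<noteq> {}" by blast
  next
    fix x assume "x \<in> N"
    then obtain f where f: "f \<in> G" "x = res f" using N_sub by blast
    then have "res (inv_into UNIV f) \<in> N"
      using \<open>x \<in> N\<close> N_image[of f "inv_into UNIV f"] G_inv lascar_on_inv by (simp add: N_iff)
    then show "inv\<^bsub>SG\<^esub> x \<in> N" using f SG_inv by simp
  next
    fix x y assume xy: "x \<in> N" "y \<in> N"
    then obtain f g where fg: "f \<in> G" "x = res f" "g \<in> G" "y = res g" using N_sub by blast
    have "lascar_on (f \<circ> g) (entries \<kappa> l \<eta> b)" if "l \<in> Field \<kappa>" "b \<in> tuples \<kappa> l sol" for l b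
      using fg xy that N_iff[OF fg(3)] N_image[OF fg(1)] by (intro lascar_on_comp) auto
    then have "res (f \<circ> g) \<in> N" using fg G_comp by (simp add: N_iff)
    then show "x \<otimes>\<^bsub>SG\<^esub> y \<in> N" using fg SG_mult by simp
  qed
  have "x \<otimes>\<^bsub>SG\<^esub> h \<otimes>\<^bsub>SG\<^esub> inv\<^bsub>SG\<^esub> x \<in> N" if xh: "x \<in> carrier SG" "h \<in> N" for x h
  proof -
    obtain g f where fg: "g \<in> G" "x = res g" "f \<in> G" "h = res f" using xh N_sub SG_carrier by blast
    have "lascar_on (g \<circ> f \<circ> inv_into UNIV g) (entries \<kappa> l \<eta> b)" if "l \<in> Field \<kappa>" "b \<in> tuples \<kappa> l sol" for l b
      using fg xh that N_image[OF fg(3)] G_inv by (intro lascar_on_conj) auto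
    then have "res (g \<circ> f \<circ> inv_into UNIV g) \<in> N" using fg G_comp G_inv by (simp add: N_iff)
    then show ?thesis using fg SG_mult SG_inv G_comp G_inv by simp
  qed
  then show ?thesis using subgroup group.normal_inv_iff[OF SG_group] by blast
qed

definition gal :: "('a \<Rightarrow> 'a) \<Rightarrow> (('k \<Rightarrow> 'a) \<Rightarrow> 'k \<Rightarrow> 'a) set" where
  "gal f = N #>\<^bsub>SG\<^esub> res f"

lemma Gal_group: "group Gal"
  unfolding Gal_L_def by (rule normal.factorgroup_is_group[OF N_normal])

lemma Gal_carrier: "carrier Gal = gal ` G"
  by (simp add: Gal_L_def carrier_FactGroup SG_carrier image_image gal_def)

lemma gal_comp: "f \<in> G \<Longrightarrow> g \<in> G \<Longrightarrow> gal (f \<circ> g) = gal f \<otimes>\<^bsub>Gal\<^esub> gal g"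
  using normal.rcos_sum[OF N_normal, of "res f" "res g"]
  by (simp add: Gal_L_def FactGroup_def gal_def SG_mult SG_carrier)

lemma gal_in_N:
  assumes "f \<in> G" "res f \<in> N" shows "gal f = \<one>\<^bsub>Gal\<^esub>"
proof -
  have "subgroup N SG" using N_normal by (rule normal_imp_subgroup)
  then have "N #>\<^bsub>SG\<^esub> res f = N"
    using assms by (intro group.coset_join2[OF SG_group]) (auto simp: SG_carrier)
  then show ?thesis by (simp add: gal_def Gal_L_def FactGroup_def)
qed

lemma gal_inv:
  assumes "f \<in> G" shows "gal (inv_into UNIV f) = inv\<^bsub>Gal\<^esub> gal f"
proof -
  have "inv_into UNIV f \<circ> f = id" using G_inv_apply[OF assms] by (auto simp: fun_eq_iff)
  moreover have "gal id = \<one>\<^bsub>Gal\<^esub>"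
    using G_id lascar_on_fix by (intro gal_in_N) (simp_all add: N_iff)
  ultimately have "gal (inv_into UNIV f) \<otimes>\<^bsub>Gal\<^esub> gal f = \<one>\<^bsub>Gal\<^esub>"
    using gal_comp[OF G_inv[OF assms] assms] by simp
  then show ?thesis using group.inv_equality[OF Gal_group] assms G_inv by (metis Gal_carrier imageI)
qed

end

context galois_setting
begin

lemma underS_small: "l \<in> Field \<kappa> \<Longrightarrow> |underS \<kappa> l| <o \<kappa>"
  by (rule card_of_underS[OF card_order])

lemma eta_Field: "\<eta> \<in> Field \<kappa>" and alpha_Field: "\<alpha> \<in> Field \<kappa>"
  using ptype hyper by (auto simp: partial_type_def hyperimaginary_def)

lemma positions_small: "l \<in> Field \<kappa> \<Longrightarrow> |positions \<kappa> l \<eta>| <o \<kappa>"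
  unfolding positions_def
  using small_Times[OF card_order uncountable underS_small underS_small[OF eta_Field]] .

lemma entries_small: "l \<in> Field \<kappa> \<Longrightarrow> |entries \<kappa> l \<eta> b| <o \<kappa>"
  unfolding entries_def using small_image[OF positions_small] .

lemma infinite_k: "infinite (UNIV :: 'k set)"
  using infinite_Field[OF card_order uncountable] finite_subset[OF subset_UNIV] by blast


abbreviation image_tp where "image_tp l b f \<equiv> image_type C \<kappa> \<eta> l b (res f)"

lemma image_tp_eq:
  assumes "b \<in> tuples \<kappa> l sol"
  shows "image_tp l b f = tp C (positions \<kappa> l \<eta>) (\<lambda>z. f (case_prod b z)) (entries \<kappa> l \<eta> b)"
proof -
  have "holds C (case_prod (compose (underS \<kappa> l) (res f) b)) \<phi> \<longleftrightarrow> holds C (\<lambda>z. f (case_prod b z)) \<phi>"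
    if "\<phi> \<in> formulas C (positions \<kappa> l \<eta>) (entries \<kappa> l \<eta> b)" for \<phi>
    using that tuple_entry[OF assms] by (intro holds_cong[OF that]) (auto simp: positions_def)
  then show ?thesis unfolding image_type_def tp_def by blast
qed

text \<open>
  Homogeneity over \<open>b\<close> gives \<open>h\<close> fixing \<open>b\<close> with \<open>h(f(b)) = g(b)\<close>, and then \<open>k = f\<^sup>-\<^sup>1h\<^sup>-\<^sup>1g\<close> fixes \<open>b\<close> too. As
  \<open>e \<in> dcl(b)\<close>, both lie in \<open>G\<close>; as \<open>b\<close> is a Lascar tuple, both are trivial in the Galois group.
\<close>
lemma gal_eq_of_type:
  assumes b: "lascar_tuple C \<kappa> \<alpha> e \<eta> \<Sigma> l b" and dcl: "in_dcl C \<kappa> \<alpha> e (entries \<kappa> l \<eta> b)"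
    and f: "f \<in> G" and g: "g \<in> G" and eq: "image_tp l b f = image_tp l b g"
  shows "gal f = gal g"
proof -
  let ?B = "entries \<kappa> l \<eta> b"
  have l: "l \<in> Field \<kappa>" and bt: "b \<in> tuples \<kappa> l sol"
    and N_eq: "N = {\<sigma> \<in> aut_sol C \<kappa> \<alpha> e \<eta> \<Sigma>. lascar_fixes C \<kappa> \<alpha> e \<eta> l b \<sigma>}"
    using b by (auto simp: lascar_tuple_def)
  have trivial: "gal h = \<one>\<^bsub>Gal\<^esub>" if h: "h \<in> G" "\<And>x. x \<in> ?B \<Longrightarrow> h x = x" for h
  proof (rule gal_in_N[OF h(1)])
    show "res h \<in> N"
      using h lascar_on_fix[of ?B h] lascar_fixes_res[OF bt] unfolding N_eq by (simp add: aut_sol_eq)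
  qed
  have inf: "infinite (UNIV :: ('k \<times> 'k) set)"
    using infinite_k by (simp add: finite_prod)
  have eq': "tp C (positions \<kappa> l \<eta>) (\<lambda>z. f (case_prod b z)) ?B = tp C (positions \<kappa> l \<eta>) (\<lambda>z. g (case_prod b z)) ?B"
    using eq by (simp only: image_tp_eq[OF bt])
  obtain h where h: "h \<in> aut C" "\<And>z. z \<in> positions \<kappa> l \<eta> \<Longrightarrow> h (f (case_prod b z)) = g (case_prod b z)"
      "\<And>x. x \<in> ?B \<Longrightarrow> h x = x"
    by (rule homogeneous[OF strongly_homogeneous card_order uncountable inf
          positions_small[OF l] entries_small[OF l] eq']) (rule that)
  have hG: "h \<in> G" using dcl h(1,3) by (simp add: in_dcl_def)
  define k where "k = inv_into UNIV f \<circ> inv_into UNIV h \<circ> g"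
  have kG: "k \<in> G" using f g hG G_comp G_inv by (simp add: k_def)
  have "k x = x" if "x \<in> ?B" for x
  proof -
    obtain z where "z \<in> positions \<kappa> l \<eta>" "x = case_prod b z" using \<open>x \<in> ?B\<close> by (auto simp: entries_def)
    then have "g x = h (f x)" using h(2) by simp
    then show ?thesis using G_inv_apply[OF hG] G_inv_apply[OF f] by (simp add: k_def)
  qed
  then have "gal k = \<one>\<^bsub>Gal\<^esub>" using trivial kG by blast
  moreover have "gal h = \<one>\<^bsub>Gal\<^esub>" using trivial hG h(3) by blast
  moreover have "g = h \<circ> f \<circ> k"
    using G_inv_apply[OF hG] G_inv_apply[OF f] by (simp add: k_def fun_eq_iff)
  ultimately have "gal g = \<one>\<^bsub>Gal\<^esub> \<otimes>\<^bsub>Gal\<^esub> gal f \<otimes>\<^bsub>Gal\<^esub> \<one>\<^bsub>Gal\<^esub>"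
    using gal_comp[OF G_comp[OF hG f] kG] gal_comp[OF hG f] by simp
  moreover have "gal f \<in> carrier Gal" using f by (simp add: Gal_carrier)
  ultimately show ?thesis using Gal_group by (simp add: group.is_monoid)
qed

lemma nu_image_tp:
  assumes b: "lascar_tuple C \<kappa> \<alpha> e \<eta> \<Sigma> l b" and dcl: "in_dcl C \<kappa> \<alpha> e (entries \<kappa> l \<eta> b)"
    and f: "f \<in> G"
  shows "nu C \<kappa> \<alpha> e \<eta> \<Sigma> l b (image_tp l b f) = gal f"
  unfolding nu_def
proof (rule the_equality)
  show "\<exists>\<sigma>\<in>aut_sol C \<kappa> \<alpha> e \<eta> \<Sigma>. image_tp l b f = image_type C \<kappa> \<eta> l b \<sigma> \<and> gal f = N #>\<^bsub>SG\<^esub> \<sigma>"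
    using f by (auto simp: aut_sol_eq gal_def)
next
  fix X assume "\<exists>\<sigma>\<in>aut_sol C \<kappa> \<alpha> e \<eta> \<Sigma>. image_tp l b f = image_type C \<kappa> \<eta> l b \<sigma> \<and> X = N #>\<^bsub>SG\<^esub> \<sigma>"
  then obtain g where "g \<in> G" "image_tp l b f = image_tp l b g" "X = gal g"
    by (auto simp: aut_sol_eq gal_def)
  then show "X = gal f" using gal_eq_of_type[OF b dcl] f by metis
qed


section \<open>The space of pairs of automorphisms\<close>

text \<open>
  In formulas about a pair \<open>(f, g)\<close>, the variable indexed by \<open>(0, s)\<close> stands for \<open>f(s)\<close>, that indexed by \<open>(1, s)\<close> for \<open>g(s)\<close>,
  and the parameter \<open>s\<close> for itself. The index type \<open>nat \<times> 'a\<close> provides infinitely many variables even when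
  \<open>C\<close> is finite.
\<close>
definition pair_assignment :: "('a \<Rightarrow> 'a) \<Rightarrow> ('a \<Rightarrow> 'a) \<Rightarrow> nat \<times> 'a \<Rightarrow> 'a" where
  "pair_assignment f g = (\<lambda>(n, s). if n = 0 then f s else g s)"

abbreviation pair_formulas :: "'a set \<Rightarrow> ('f, 'r, nat \<times> 'a + 'a) form set" where
  "pair_formulas S \<equiv> formulas C ({0, 1} \<times> S) S"

definition pairs_satisfying :: "('f, 'r, nat \<times> 'a + 'a) form \<Rightarrow> (('a \<Rightarrow> 'a) \<times> ('a \<Rightarrow> 'a)) set" where
  "pairs_satisfying \<phi> = {(f, g) \<in> G \<times> G. holds C (pair_assignment f g) \<phi>}"

definition pair_space :: "'a set \<Rightarrow> (('a \<Rightarrow> 'a) \<times> ('a \<Rightarrow> 'a)) topology" where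
  "pair_space S = topology_generated_by (pairs_satisfying ` pair_formulas S)"

lemma topspace_pair_space: "topspace (pair_space S) = G \<times> G"
proof -
  have "pairs_satisfying verum = G \<times> G" by (auto simp: pairs_satisfying_def)
  then have "G \<times> G \<in> pairs_satisfying ` pair_formulas S" by (metis imageI verum_formulas)
  moreover have "pairs_satisfying \<phi> \<subseteq> G \<times> G" for \<phi> by (auto simp: pairs_satisfying_def)
  ultimately show ?thesis
    unfolding pair_space_def topology_generated_by_topspace by blast
qed

lemma openin_pairs_satisfying: "\<phi> \<in> pair_formulas S \<Longrightarrow> openin (pair_space S) (pairs_satisfying \<phi>)"
  unfolding pair_space_def by (rule topology_generated_by_Basis) blast

lemma pair_space_basis:
  assumes "openin (pair_space S) U" "z \<in> U"
  shows "\<exists>\<phi>\<in>pair_formulas S. z \<in> pairs_satisfying \<phi> \<and> pairs_satisfying \<phi> \<subseteq> U"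
proof -
  have "generate_topology_on (pairs_satisfying ` pair_formulas S) U"
    using assms(1) unfolding pair_space_def by (rule openin_topology_generated_by)
  then have "\<forall>z\<in>U. \<exists>\<phi>\<in>pair_formulas S. z \<in> pairs_satisfying \<phi> \<and> pairs_satisfying \<phi> \<subseteq> U"
  proof (induction rule: generate_topology_on.induct)
    case (Int U V)
    show ?case
    proof
      fix z assume "z \<in> U \<inter> V"
      then obtain \<phi> \<psi> where "\<phi> \<in> pair_formulas S" "z \<in> pairs_satisfying \<phi>" "pairs_satisfying \<phi> \<subseteq> U"
        "\<psi> \<in> pair_formulas S" "z \<in> pairs_satisfying \<psi>" "pairs_satisfying \<psi> \<subseteq> V"
        using Int.IH by blast
      then show "\<exists>\<phi>\<in>pair_formulas S. z \<in> pairs_satisfying \<phi> \<and> pairs_satisfying \<phi> \<subseteq> U \<inter> V"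
        by (intro bexI[of _ "Conj \<phi> \<psi>"] Conj_formulas) (auto simp: pairs_satisfying_def)
    qed
  next
    case (UN K)
    then show ?case by (meson UnionE Union_upper order_trans)
  qed auto
  then show ?thesis using assms(2) by blast
qed

text \<open>
  With \<open>e = a\<^sub>E\<close>, an automorphism \<open>f\<close> maps \<open>e\<close> to the class of \<open>f(a)\<close>, so that \<open>f(e) = e\<close> means \<open>E(a, f(a))\<close>; and \<open>E\<close> is
  defined by formulas.
\<close>
lemma e_representative:
  obtains a \<Phi> where "a \<in> tuples \<kappa> \<alpha> UNIV" "\<Phi> \<subseteq> formulas C (underS \<kappa> \<alpha> <+> underS \<kappa> \<alpha>) {}"
    "\<And>f. f \<in> aut C \<Longrightarrow> f \<in> G \<longleftrightarrow> (\<forall>\<phi>\<in>\<Phi>. holds C (case_sum a (f \<circ> a)) \<phi>)"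
proof -
  let ?I = "underS \<kappa> \<alpha>"
  obtain E where E: "equiv (tuples \<kappa> \<alpha> UNIV) E" "type_definable_rel C \<kappa> \<alpha> E" "e \<in> tuples \<kappa> \<alpha> UNIV // E"
    using hyper unfolding hyperimaginary_def by blast
  obtain \<Phi> where \<Phi>: "\<Phi> \<subseteq> formulas C (?I <+> ?I) {}"
    "E = {(s, t). s \<in> tuples \<kappa> \<alpha> UNIV \<and> t \<in> tuples \<kappa> \<alpha> UNIV \<and> (\<forall>\<phi>\<in>\<Phi>. holds C (case_sum s t) \<phi>)}"
    using E(2) unfolding type_definable_rel_def by blast
  obtain a where a: "a \<in> tuples \<kappa> \<alpha> UNIV" "e = E `` {a}"
    using E(3) by (auto elim: quotientE)
  have tup: "compose ?I f t \<in> tuples \<kappa> \<alpha> UNIV" for f :: "'a \<Rightarrow> 'a" and t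
    by (auto simp: tuples_def compose_def)
  have holds_compose: "holds C (case_sum (compose ?I f s) (compose ?I f t)) \<phi> \<longleftrightarrow> holds C (case_sum s t) \<phi>"
    if "f \<in> aut C" "\<phi> \<in> \<Phi>" for f s t \<phi>
  proof -
    have \<phi>: "wf_form C \<phi>" "fv \<phi> \<subseteq> (?I <+> ?I) <+> {}" using \<open>\<phi> \<in> \<Phi>\<close> \<Phi>(1) by (auto simp: formulas_def)
    have "sat C UNIV (case_sum (case_sum (compose ?I f s) (compose ?I f t)) id) \<phi> \<longleftrightarrow>
        sat C UNIV (f \<circ> case_sum (case_sum s t) id) \<phi>"
      using \<phi>(2) by (intro sat_cong) (auto simp: compose_def)
    then show ?thesis unfolding holds_def using sat_UNIV_aut[OF \<open>f \<in> aut C\<close> \<phi>(1)] by blast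
  qed
  have E_aut: "(compose ?I f s, compose ?I f t) \<in> E" if "f \<in> aut C" "(s, t) \<in> E" for f s t
    using that holds_compose tup unfolding \<Phi>(2) by blast
  have "f \<in> G \<longleftrightarrow> (\<forall>\<phi>\<in>\<Phi>. holds C (case_sum a (f \<circ> a)) \<phi>)" if f: "f \<in> aut C" for f
  proof -
    have "compose ?I f ` (E `` {a}) = E `` {compose ?I f a}"
    proof (intro subset_antisym subsetI)
      fix t assume "t \<in> compose ?I f ` (E `` {a})"
      then show "t \<in> E `` {compose ?I f a}" using E_aut[OF f] by blast
    next
      fix t assume "t \<in> E `` {compose ?I f a}"
      then have "(compose ?I f a, t) \<in> E" by simp
      then have "(compose ?I (inv_into UNIV f) (compose ?I f a), compose ?I (inv_into UNIV f) t) \<in> E"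
        and t: "t \<in> tuples \<kappa> \<alpha> UNIV"
        using E_aut[OF aut_inv[OF f]] unfolding \<Phi>(2) by blast+
      moreover have "compose ?I (inv_into UNIV f) (compose ?I f a) = a"
        using a(1) aut_inv_apply(2)[OF f] by (auto simp: compose_def tuples_def PiE_def extensional_def)
      moreover have "compose ?I f (compose ?I (inv_into UNIV f) t) = t"
        using t aut_inv_apply(1)[OF f] by (auto simp: compose_def tuples_def PiE_def extensional_def)
      ultimately show "t \<in> compose ?I f ` (E `` {a})" by (metis Image_singleton_iff imageI)
    qed
    then have "f \<in> G \<longleftrightarrow> E `` {compose ?I f a} = E `` {a}" using f by (simp add: aut_e_def a(2))
    also have "\<dots> \<longleftrightarrow> (a, compose ?I f a) \<in> E"
      using eq_equiv_class_iff[OF E(1) a(1) tup] by blast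
    also have "\<dots> \<longleftrightarrow> (\<forall>\<phi>\<in>\<Phi>. holds C (case_sum a (compose ?I f a)) \<phi>)"
      using a(1) tup by (simp add: \<Phi>(2))
    also have "\<dots> \<longleftrightarrow> (\<forall>\<phi>\<in>\<Phi>. holds C (case_sum a (f \<circ> a)) \<phi>)"
    proof (intro ball_cong refl)
      fix \<phi> assume "\<phi> \<in> \<Phi>"
      then have "\<phi> \<in> formulas C (?I <+> ?I) {}" using \<Phi>(1) by blast
      then show "holds C (case_sum a (compose ?I f a)) \<phi> \<longleftrightarrow> holds C (case_sum a (f \<circ> a)) \<phi>"
        by (rule holds_cong) (auto simp: compose_def)
    qed
    finally show ?thesis .
  qed
  then show thesis using that a(1) \<Phi>(1) by blast
qed

text \<open>
  A small \<open>S\<close> containing the entries of a tuple \<open>a\<close> through which membership in \<open>G\<close> is a closed condition on \<open>f(a)\<close>.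
\<close>
definition represents_e :: "'a set \<Rightarrow> bool" where
  "represents_e S \<longleftrightarrow> |S| <o \<kappa> \<and> (\<exists>a \<Phi>. \<Phi> \<subseteq> formulas C (underS \<kappa> \<alpha> <+> underS \<kappa> \<alpha>) {} \<and> a ` underS \<kappa> \<alpha> \<subseteq> S \<and>
    (\<forall>f\<in>aut C. f \<in> G \<longleftrightarrow> (\<forall>\<phi>\<in>\<Phi>. holds C (case_sum a (f \<circ> a)) \<phi>)))"

lemma small_representing_set:
  assumes "|B| <o \<kappa>" obtains S where "represents_e S" "B \<subseteq> S"
proof -
  obtain a :: "'k \<Rightarrow> 'a" and \<Phi> where a: "\<Phi> \<subseteq> formulas C (underS \<kappa> \<alpha> <+> underS \<kappa> \<alpha>) {}"
    "\<And>f. f \<in> aut C \<Longrightarrow> f \<in> G \<longleftrightarrow> (\<forall>\<phi>\<in>\<Phi>. holds C (case_sum a (f \<circ> a)) \<phi>)"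
    using e_representative by metis
  have "|B \<union> a ` underS \<kappa> \<alpha>| <o \<kappa>"
    using small_Un[OF card_order uncountable assms small_image[OF underS_small[OF alpha_Field]]] .
  then have "represents_e (B \<union> a ` underS \<kappa> \<alpha>)" unfolding represents_e_def using a by blast
  then show thesis using that by blast
qed

text \<open>
  To the given conditions, all those valid for every pair in \<open>G\<close> are added. They say in particular that the
  two halves of a realisation are elementary maps on \<open>S\<close> and preserve the class of the representative of \<open>e\<close>, so
  the halves extend to elements of \<open>G\<close>.
\<close>
lemma pair_compactness:
  assumes S: "represents_e S" and \<Theta>: "\<Theta> \<subseteq> pair_formulas S"
    and fin: "\<And>F. finite F \<Longrightarrow> F \<subseteq> \<Theta> \<Longrightarrow> \<exists>f\<in>G. \<exists>g\<in>G. \<forall>\<phi>\<in>F. holds C (pair_assignment f g) \<phi>"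
  shows "\<exists>f\<in>G. \<exists>g\<in>G. \<forall>\<phi>\<in>\<Theta>. holds C (pair_assignment f g) \<phi>"
proof -
  let ?I = "underS \<kappa> \<alpha>"
  have small: "|S| <o \<kappa>" using S by (simp add: represents_e_def)
  obtain a \<Phi> where \<Phi>: "\<Phi> \<subseteq> formulas C (?I <+> ?I) {}" and a: "a ` ?I \<subseteq> S"
    and G_iff: "\<And>f. f \<in> aut C \<Longrightarrow> f \<in> G \<longleftrightarrow> (\<forall>\<phi>\<in>\<Phi>. holds C (case_sum a (f \<circ> a)) \<phi>)"
    using S unfolding represents_e_def by metis
  define \<Psi> where "\<Psi> = {\<psi> \<in> pair_formulas S. \<forall>f\<in>G. \<forall>g\<in>G. holds C (pair_assignment f g) \<psi>}"
  have "finitely_satisfiable C (\<Psi> \<union> \<Theta>)"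
    unfolding finitely_satisfiable_def
  proof (intro allI impI, elim conjE)
    fix F assume F: "finite F" "F \<subseteq> \<Psi> \<union> \<Theta>"
    have "finite (F \<inter> \<Theta>)" "F \<inter> \<Theta> \<subseteq> \<Theta>" using F(1) by auto
    then obtain f g where fg: "f \<in> G" "g \<in> G" "\<forall>\<phi>\<in>F \<inter> \<Theta>. holds C (pair_assignment f g) \<phi>"
      using fin by metis
    have "holds C (pair_assignment f g) \<phi>" if "\<phi> \<in> F" for \<phi>
      using fg F(2) that by (cases "\<phi> \<in> \<Theta>") (auto simp: \<Psi>_def)
    then show "\<exists>t. \<forall>\<phi>\<in>F. holds C t \<phi>" by blast
  qed
  moreover have "|({0, 1} :: nat set) \<times> S| <o \<kappa>"
    by (rule small_Times[OF card_order uncountable small_finite[OF uncountable] small]) simp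
  moreover have "\<Psi> \<union> \<Theta> \<subseteq> pair_formulas S" using \<Theta> by (auto simp: \<Psi>_def)
  ultimately obtain t where t: "\<And>\<phi>. \<phi> \<in> \<Psi> \<union> \<Theta> \<Longrightarrow> holds C t \<phi>"
    using saturated_small_tuple[OF saturated card_order uncountable _ small] by blast
  have inf: "infinite (UNIV :: (nat \<times> 'a) set)" by (simp add: finite_prod)
  have extension: "\<exists>f\<in>G. \<forall>s\<in>S. f s = t (n, s)" if n: "n \<in> {0, 1}" for n
  proof -
    have pa: "(if n = 0 then f else g) s = pair_assignment f g (n, s)" for f g s
      using n by (auto simp: pair_assignment_def)
    have true_in_t: "holds C t \<psi>" if "\<psi> \<in> pair_formulas S" "\<And>f g. f \<in> G \<Longrightarrow> g \<in> G \<Longrightarrow> holds C (pair_assignment f g) \<psi>" for \<psi>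
      using t that by (auto simp: \<Psi>_def)
    have sub: "formulas C ({n} \<times> S) {} \<subseteq> pair_formulas S" using n by (intro formulas_mono) auto
    have true_t: "holds C t \<psi>" if \<psi>: "\<psi> \<in> formulas C ({n} \<times> S) {}" "holds C snd \<psi>" for \<psi>
    proof (rule true_in_t)
      show "\<psi> \<in> pair_formulas S" using \<psi>(1) sub by blast
      fix f g assume fg: "f \<in> G" "g \<in> G"
      let ?h = "if n = 0 then f else g"
      have h: "?h \<in> aut C" using fg G_aut by simp
      have wf: "wf_form C \<psi>" "fv \<psi> \<subseteq> ({n} \<times> S) <+> {}" using \<psi>(1) by (auto simp: formulas_def)
      have "holds C (pair_assignment f g) \<psi> \<longleftrightarrow> sat C UNIV (?h \<circ> case_sum snd id) \<psi>"
        unfolding holds_def using wf(2) pa[of f g] by (intro sat_cong) auto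
      then show "holds C (pair_assignment f g) \<psi>"
        using sat_UNIV_aut[OF h wf(1)] \<psi>(2) by (simp add: holds_def)
    qed
    have "\<psi> \<in> tp C ({n} \<times> S) snd {} \<longleftrightarrow> \<psi> \<in> tp C ({n} \<times> S) t {}" for \<psi>
      using true_t[of \<psi>] true_t[of "Neg \<psi>"] Neg_formulas[of \<psi>] by (auto simp: tp_def)
    then have eq: "tp C ({n} \<times> S) snd {} = tp C ({n} \<times> S) t {}" by blast
    have small_n: "|{n} \<times> S| <o \<kappa>"
      by (rule small_Times[OF card_order uncountable small_finite[OF uncountable] small]) simp
    have small_0: "|{} :: 'a set| <o \<kappa>" by (rule small_finite[OF uncountable]) simp
    obtain f where f: "f \<in> aut C" "\<And>z. z \<in> {n} \<times> S \<Longrightarrow> f (snd z) = t z"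
      by (rule homogeneous[OF strongly_homogeneous card_order uncountable inf small_n small_0 eq]) (rule that)
    have f_t: "f s = t (n, s)" if "s \<in> S" for s using f(2)[of "(n, s)"] that by simp
    have "holds C (case_sum a (f \<circ> a)) \<phi>" if \<phi>: "\<phi> \<in> \<Phi>" for \<phi>
    proof -
      define \<tau> :: "('k + 'k) + 'a \<Rightarrow> nat \<times> 'a + 'a" where
        "\<tau> = case_sum (case_sum (\<lambda>i. Inr (a i)) (\<lambda>i. Inl (n, a i))) Inr"
      have \<phi>F: "\<phi> \<in> formulas C (?I <+> ?I) {}" using \<phi> \<Phi> by blast
      have "\<tau> ` ((?I <+> ?I) <+> {}) \<subseteq> ({0, 1} \<times> S) <+> S" using a n by (auto simp: \<tau>_def)
      then obtain \<psi> where \<psi>: "\<psi> \<in> pair_formulas S"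
        "\<And>u. holds C u \<psi> \<longleftrightarrow> sat C UNIV (case_sum u id \<circ> \<tau>) \<phi>"
        using rename_formula[OF inf \<phi>F] by metis
      have "case_sum u id \<circ> \<tau> = case_sum (case_sum a (\<lambda>i. u (n, a i))) id" for u
        by (auto simp: \<tau>_def fun_eq_iff split: sum.split)
      then have \<psi>_iff: "holds C u \<psi> \<longleftrightarrow> holds C (case_sum a (\<lambda>i. u (n, a i))) \<phi>" for u
        using \<psi>(2)[of u] by (simp add: holds_def)
      have "holds C (pair_assignment f g) \<psi>" if "f \<in> G" "g \<in> G" for f g
      proof -
        have "(if n = 0 then f else g) \<in> G" using that by simp
        then have "holds C (case_sum a ((if n = 0 then f else g) \<circ> a)) \<phi>" using G_iff G_aut \<phi> by blast
        moreover have "(if n = 0 then f else g) \<circ> a = (\<lambda>i. pair_assignment f g (n, a i))"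
          using pa[of f g] by (auto simp: fun_eq_iff)
        ultimately show ?thesis by (simp only: \<psi>_iff)
      qed
      then have "holds C t \<psi>" using true_in_t \<psi>(1) by blast
      then have "holds C (case_sum a (\<lambda>i. t (n, a i))) \<phi>" by (simp only: \<psi>_iff)
      moreover have "holds C (case_sum a (f \<circ> a)) \<phi> \<longleftrightarrow> holds C (case_sum a (\<lambda>i. t (n, a i))) \<phi>"
        by (rule holds_cong[OF \<phi>F]) (use a f_t in auto)
      ultimately show ?thesis by blast
    qed
    then have "f \<in> G" using G_iff f(1) by blast
    then show ?thesis using f_t by blast
  qed
  obtain f g where fg: "f \<in> G" "\<forall>s\<in>S. f s = t (0, s)" "g \<in> G" "\<forall>s\<in>S. g s = t (1, s)"
    using extension[of 0] extension[of 1] by auto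
  have "holds C (pair_assignment f g) \<phi>" if \<phi>: "\<phi> \<in> \<Theta>" for \<phi>
  proof -
    have "holds C (pair_assignment f g) \<phi> \<longleftrightarrow> holds C t \<phi>"
      using fg by (intro holds_cong[OF subsetD[OF \<Theta> \<phi>]]) (auto simp: pair_assignment_def)
    then show ?thesis using t \<phi> by blast
  qed
  then show ?thesis using fg by blast
qed

lemma compact_pair_space:
  assumes S: "represents_e S" shows "compact_space (pair_space S)"
  unfolding compact_space_alt topspace_pair_space
proof (intro allI impI)
  fix \<U> assume "(\<forall>U\<in>\<U>. openin (pair_space S) U) \<and> G \<times> G \<subseteq> \<Union>\<U>"
  then have op: "\<And>U. U \<in> \<U> \<Longrightarrow> openin (pair_space S) U" and cov: "G \<times> G \<subseteq> \<Union>\<U>" by blast+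
  define \<Theta> where "\<Theta> = {Neg \<phi> | \<phi>. \<phi> \<in> pair_formulas S \<and> (\<exists>U\<in>\<U>. pairs_satisfying \<phi> \<subseteq> U)}"
  have \<Theta>_sub: "\<Theta> \<subseteq> pair_formulas S" unfolding \<Theta>_def using Neg_formulas by blast
  have "\<not> (\<exists>f\<in>G. \<exists>g\<in>G. \<forall>\<phi>\<in>\<Theta>. holds C (pair_assignment f g) \<phi>)"
  proof
    assume "\<exists>f\<in>G. \<exists>g\<in>G. \<forall>\<phi>\<in>\<Theta>. holds C (pair_assignment f g) \<phi>"
    then obtain f g where fg: "f \<in> G" "g \<in> G" "\<forall>\<phi>\<in>\<Theta>. holds C (pair_assignment f g) \<phi>" by blast
    then obtain U where U: "U \<in> \<U>" "(f, g) \<in> U" using cov by blast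
    obtain \<phi> where "\<phi> \<in> pair_formulas S" "(f, g) \<in> pairs_satisfying \<phi>" "pairs_satisfying \<phi> \<subseteq> U"
      using pair_space_basis[OF op[OF U(1)] U(2)] by blast
    then have "Neg \<phi> \<in> \<Theta>" "holds C (pair_assignment f g) \<phi>"
      using U(1) by (auto simp: \<Theta>_def pairs_satisfying_def)
    then show False using fg(3) by fastforce
  qed
  then obtain F where F: "finite F" "F \<subseteq> \<Theta>"
    "\<not> (\<exists>f\<in>G. \<exists>g\<in>G. \<forall>\<phi>\<in>F. holds C (pair_assignment f g) \<phi>)"
    using pair_compactness[OF S \<Theta>_sub] by metis
  have "\<forall>\<psi>\<in>F. \<exists>\<phi> U. \<psi> = Neg \<phi> \<and> U \<in> \<U> \<and> pairs_satisfying \<phi> \<subseteq> U" using F(2) unfolding \<Theta>_def by blast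
  then obtain p u where pu: "\<And>\<psi>. \<psi> \<in> F \<Longrightarrow> \<psi> = Neg (p \<psi>) \<and> u \<psi> \<in> \<U> \<and> pairs_satisfying (p \<psi>) \<subseteq> u \<psi>"
    by metis
  have "G \<times> G \<subseteq> \<Union>(u ` F)"
  proof
    fix z assume "z \<in> G \<times> G"
    then obtain f g where fg: "z = (f, g)" "f \<in> G" "g \<in> G" by blast
    then obtain \<psi> where \<psi>: "\<psi> \<in> F" "\<not> holds C (pair_assignment f g) \<psi>" using F(3) by blast
    then have "holds C (pair_assignment f g) (p \<psi>)" using pu[OF \<psi>(1)] holds_Neg by metis
    then have "z \<in> u \<psi>" using fg pu[OF \<psi>(1)] by (auto simp: pairs_satisfying_def)
    then show "z \<in> \<Union>(u ` F)" using \<psi>(1) by blast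
  qed
  moreover have "u ` F \<subseteq> \<U>" using pu by blast
  ultimately show "\<exists>\<F>. finite \<F> \<and> \<F> \<subseteq> \<U> \<and> G \<times> G \<subseteq> \<Union>\<F>"
    using F(1) by (intro exI[of _ "u ` F"]) simp
qed

end


section \<open>The Galois topology\<close>

lemma Hausdorff_logic_topology: "Hausdorff_space (logic_topology C I A)"
  unfolding Hausdorff_space_def
proof (intro allI impI, elim conjE)
  let ?X = "logic_topology C I A"
  let ?U = "\<lambda>\<phi>. {p \<in> complete_types C I A. \<phi> \<in> p}"
  fix p q assume pq: "p \<in> topspace ?X" "q \<in> topspace ?X" "p \<noteq> q"
  have "topspace ?X \<subseteq> complete_types C I A"
    unfolding logic_topology_def topology_generated_by_topspace by blast
  then have ct: "p \<in> complete_types C I A" "q \<in> complete_types C I A" using pq by blast+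
  have open_U: "openin ?X (?U \<phi>)" if "\<phi> \<in> formulas C I A" for \<phi>
    unfolding logic_topology_def using that by (intro topology_generated_by_Basis) blast
  have disj: "disjnt (?U \<phi>) (?U (Neg \<phi>))" for \<phi>
  proof -
    have False if "r \<in> complete_types C I A" "\<phi> \<in> r" "Neg \<phi> \<in> r" for r
    proof -
      have "finitely_satisfiable C r" using that(1) by (simp add: complete_types_def)
      then have "\<exists>t. \<forall>\<psi>\<in>{\<phi>, Neg \<phi>}. holds C t \<psi>"
        using that(2,3) unfolding finitely_satisfiable_def by (metis empty_subsetI finite.emptyI finite_insert insert_subset)
      then show False by simp
    qed
    then show ?thesis by (auto simp: disjnt_iff)
  qed
  have separate: "\<exists>\<phi>\<in>formulas C I A. \<phi> \<in> p \<and> Neg \<phi> \<in> q"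
    if "p \<in> complete_types C I A" "q \<in> complete_types C I A" "\<not> p \<subseteq> q" for p q
    using that unfolding complete_types_def by blast
  consider "\<not> p \<subseteq> q" | "\<not> q \<subseteq> p" using pq(3) by blast
  then show "\<exists>U V. openin ?X U \<and> openin ?X V \<and> p \<in> U \<and> q \<in> V \<and> disjnt U V"
  proof cases
    case 1
    then obtain \<phi> where "\<phi> \<in> formulas C I A" "\<phi> \<in> p" "Neg \<phi> \<in> q" using separate ct by blast
    then have "openin ?X (?U \<phi>)" "openin ?X (?U (Neg \<phi>))" "p \<in> ?U \<phi>" "q \<in> ?U (Neg \<phi>)"
      using open_U open_U[OF Neg_formulas] ct by auto
    then show ?thesis using disj[of \<phi>] by (intro exI conjI)
  next
    case 2
    then obtain \<phi> where "\<phi> \<in> formulas C I A" "\<phi> \<in> q" "Neg \<phi> \<in> p" using separate ct by blast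
    then have "openin ?X (?U (Neg \<phi>))" "openin ?X (?U \<phi>)" "p \<in> ?U (Neg \<phi>)" "q \<in> ?U \<phi>"
      using open_U open_U[OF Neg_formulas] ct by auto
    then show ?thesis using disjnt_sym[OF disj[of \<phi>]] by (intro exI conjI)
  qed
qed

lemma topspace_logic_topology: "topspace (logic_topology C I A) = complete_types C I A"
proof -
  have "verum \<in> p" if "p \<in> complete_types C I A" for p
  proof (rule ccontr)
    assume "verum \<notin> p"
    then have "{Neg verum} \<subseteq> p" and fs: "finitely_satisfiable C p"
      using that verum_formulas[of C I A] by (auto simp: complete_types_def)
    then have "\<exists>t. \<forall>\<psi>\<in>{Neg verum}. holds C t \<psi>"
      using fs[unfolded finitely_satisfiable_def, rule_format, of "{Neg verum}"] by simp
    then show False by simp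
  qed
  then have "complete_types C I A \<subseteq> {p \<in> complete_types C I A. verum \<in> p}" by blast
  then have "complete_types C I A \<subseteq> \<Union> ((\<lambda>\<phi>. {p \<in> complete_types C I A. \<phi> \<in> p}) ` formulas C I A)"
    by (rule order_trans) (intro Union_upper imageI verum_formulas)
  then show ?thesis
    unfolding logic_topology_def topology_generated_by_topspace by (intro subset_antisym) auto
qed

context galois_setting
begin

abbreviation type_space where "type_space l b \<equiv> image_types C \<kappa> \<alpha> e \<eta> \<Sigma> l b"

lemma topspace_image_types:
  assumes "b \<in> tuples \<kappa> l sol" shows "topspace (type_space l b) = image_tp l b ` G"
proof -
  have "image_tp l b ` G \<subseteq> complete_types C (positions \<kappa> l \<eta>) (entries \<kappa> l \<eta> b)"
    using tp_complete_type by (auto simp: image_type_def)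
  then show ?thesis
    unfolding image_types_def by (auto simp: topspace_logic_topology aut_sol_eq)
qed

lemma Hausdorff_image_types: "Hausdorff_space (type_space l b)"
  unfolding image_types_def by (intro Hausdorff_space_subtopology Hausdorff_logic_topology)

lemma continuous_type:
  assumes b: "b \<in> tuples \<kappa> l sol" and S: "entries \<kappa> l \<eta> b \<subseteq> S" and h: "h = fst \<or> h = snd"
  shows "continuous_map (pair_space S) (type_space l b) (\<lambda>z. image_tp l b (h z))"
proof -
  let ?P = "positions \<kappa> l \<eta>" and ?B = "entries \<kappa> l \<eta> b"
  have h_G: "h z \<in> G" if "z \<in> G \<times> G" for z using h that by auto
  obtain n :: nat where n: "n \<in> {0, 1}" "\<And>f g s. pair_assignment f g (n, s) = h (f, g) s"
  proof (cases "h = fst")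
    case True
    then show thesis using that[of 0] by (simp add: pair_assignment_def)
  next
    case False
    then show thesis using that[of 1] h by (simp add: pair_assignment_def)
  qed
  have inf: "infinite (UNIV :: (nat \<times> 'a) set)" by (simp add: finite_prod)
  have "continuous_map (pair_space S) (logic_topology C ?P ?B) (\<lambda>z. image_tp l b (h z))"
    unfolding logic_topology_def
  proof (rule continuous_on_generated_topo)
    fix U assume "U \<in> (\<lambda>\<phi>. {p \<in> complete_types C ?P ?B. \<phi> \<in> p}) ` formulas C ?P ?B"
    then obtain \<phi> where \<phi>: "\<phi> \<in> formulas C ?P ?B" "U = {p \<in> complete_types C ?P ?B. \<phi> \<in> p}" by blast
    define \<tau> :: "'k \<times> 'k + 'a \<Rightarrow> nat \<times> 'a + 'a" where
      "\<tau> = case_sum (\<lambda>z. Inl (n, case_prod b z)) Inr"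
    have "\<tau> ` (?P <+> ?B) \<subseteq> ({0, 1} \<times> S) <+> S" using S n(1) by (auto simp: \<tau>_def entries_def)
    then obtain \<psi> where \<psi>: "\<psi> \<in> pair_formulas S"
      "\<And>u. holds C u \<psi> \<longleftrightarrow> sat C UNIV (case_sum u id \<circ> \<tau>) \<phi>"
      using rename_formula[OF inf \<phi>(1)] by metis
    have "case_sum u id \<circ> \<tau> = case_sum (\<lambda>z. u (n, case_prod b z)) id" for u
      by (auto simp: \<tau>_def fun_eq_iff split: sum.split)
    then have "holds C (pair_assignment f g) \<psi> \<longleftrightarrow> \<phi> \<in> image_tp l b (h (f, g))" for f g
      using \<psi>(2)[of "pair_assignment f g"] \<phi>(1) n(2) by (simp add: image_tp_eq[OF b] tp_def holds_def)
    moreover have "image_tp l b f \<in> complete_types C ?P ?B" for f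
      using tp_complete_type by (simp add: image_type_def)
    ultimately have "(\<lambda>z. image_tp l b (h z)) -` U \<inter> topspace (pair_space S) = pairs_satisfying \<psi>"
      unfolding topspace_pair_space pairs_satisfying_def \<phi>(2) by auto
    then show "openin (pair_space S) ((\<lambda>z. image_tp l b (h z)) -` U \<inter> topspace (pair_space S))"
      using openin_pairs_satisfying[OF \<psi>(1)] by simp
  next
    have "image_tp l b f \<in> topspace (logic_topology C ?P ?B)" for f
      unfolding topspace_logic_topology using tp_complete_type by (simp add: image_type_def)
    then show "(\<lambda>z. image_tp l b (h z)) ` topspace (pair_space S) \<subseteq>
        \<Union> ((\<lambda>\<phi>. {p \<in> complete_types C ?P ?B. \<phi> \<in> p}) ` formulas C ?P ?B)"
      unfolding logic_topology_def topology_generated_by_topspace by blast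
  qed
  then show ?thesis
    unfolding image_types_def continuous_map_in_subtopology
    using h_G by (auto simp: topspace_pair_space aut_sol_eq)
qed

text \<open>
  A formula about \<open>f\<^sup>-\<^sup>1(g(s))\<close> and parameters \<open>s\<close> becomes, after applying \<open>f\<close>, a formula about \<open>g(s)\<close> and \<open>f(s)\<close>. Closed
  subsets of the Galois group are tested on the first component, so this carries the continuity of division.
\<close>
lemma continuous_division:
  "continuous_map (pair_space S) (pair_space S) (\<lambda>(f, g). (inv_into UNIV f \<circ> g, id))"
  unfolding pair_space_def[of S]
proof (rule continuous_on_generated_topo, fold pair_space_def)
  have inf: "infinite (UNIV :: (nat \<times> 'a) set)" by (simp add: finite_prod)
  let ?\<delta> = "\<lambda>(f :: 'a \<Rightarrow> 'a, g :: 'a \<Rightarrow> 'a). (inv_into UNIV f \<circ> g, id :: 'a \<Rightarrow> 'a)"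
  fix U assume "U \<in> pairs_satisfying ` pair_formulas S"
  then obtain \<phi> where \<phi>: "\<phi> \<in> pair_formulas S" "U = pairs_satisfying \<phi>" by blast
  define \<tau> :: "nat \<times> 'a + 'a \<Rightarrow> nat \<times> 'a + 'a" where
    "\<tau> = case_sum (\<lambda>(n, s). Inl (if n = 0 then 1 else 0, s)) (\<lambda>s. Inl (0, s))"
  have "\<tau> ` (({0, 1} \<times> S) <+> S) \<subseteq> ({0, 1} \<times> S) <+> S" by (auto simp: \<tau>_def)
  then obtain \<psi> where \<psi>: "\<psi> \<in> pair_formulas S"
    "\<And>u. holds C u \<psi> \<longleftrightarrow> sat C UNIV (case_sum u id \<circ> \<tau>) \<phi>"
    using rename_formula[OF inf \<phi>(1)] by metis
  have wf: "wf_form C \<phi>" using \<phi>(1) by (simp add: formulas_def)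
  have "holds C (pair_assignment f g) \<psi> \<longleftrightarrow> holds C (pair_assignment (inv_into UNIV f \<circ> g) id) \<phi>"
    if f: "f \<in> G" for f g
  proof -
    have "case_sum (pair_assignment f g) id \<circ> \<tau> = f \<circ> case_sum (pair_assignment (inv_into UNIV f \<circ> g) id) id"
      using G_inv_apply[OF f] by (auto simp: \<tau>_def pair_assignment_def fun_eq_iff split: sum.split)
    then show ?thesis
      using \<psi>(2)[of "pair_assignment f g"] sat_UNIV_aut[OF G_aut[OF f] wf] by (simp only: holds_def)
  qed
  then have "?\<delta> -` U \<inter> topspace (pair_space S) = pairs_satisfying \<psi>"
    unfolding topspace_pair_space pairs_satisfying_def \<phi>(2) using G_comp G_inv G_id by auto
  then show "openin (pair_space S) (?\<delta> -` U \<inter> topspace (pair_space S))"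
    using openin_pairs_satisfying[OF \<psi>(1)] by simp
next
  show "(\<lambda>(f, g). (inv_into UNIV f \<circ> g, id)) ` topspace (pair_space S) \<subseteq> \<Union> (pairs_satisfying ` pair_formulas S)"
    using topspace_pair_space[of S] G_comp G_inv G_id
    unfolding pair_space_def topology_generated_by_topspace by auto
qed

end

locale lascar_setting = galois_setting C T \<kappa> \<alpha> \<eta> e \<Sigma>
  for C :: "('f, 'r, 'a) fo_structure" and T :: "('f, 'r, nat) form set" and \<kappa> :: "'k rel"
    and \<alpha> \<eta> :: 'k and e :: "('k \<Rightarrow> 'a) set" and \<Sigma> :: "('f, 'r, 'k + 'a) form set" +
  fixes l :: 'k and b :: "'k \<Rightarrow> 'k \<Rightarrow> 'a"
  assumes lascar: "lascar_tuple C \<kappa> \<alpha> e \<eta> \<Sigma> l b" and dcl: "in_dcl C \<kappa> \<alpha> e (entries \<kappa> l \<eta> b)"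
begin

abbreviation \<nu> where "\<nu> \<equiv> nu C \<kappa> \<alpha> e \<eta> \<Sigma> l b"

lemma b_tuple: "b \<in> tuples \<kappa> l sol" and l_Field: "l \<in> Field \<kappa>"
  using lascar by (auto simp: lascar_tuple_def)

lemma nu_image: "\<nu> ` topspace (type_space l b) = carrier Gal"
proof -
  have "\<nu> ` image_tp l b ` G = gal ` G"
    unfolding image_image using nu_image_tp[OF lascar dcl] by (intro image_cong) auto
  then show ?thesis by (simp add: topspace_image_types[OF b_tuple] Gal_carrier)
qed

lemma compact_image_types: "compact_space (type_space l b)"
proof -
  obtain S where S: "represents_e S" "entries \<kappa> l \<eta> b \<subseteq> S"
    using small_representing_set[OF entries_small[OF l_Field]] by blast
  have "compactin (type_space l b) ((\<lambda>z. image_tp l b (fst z)) ` topspace (pair_space S))"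
    using compact_pair_space[OF S(1)] continuous_type[OF b_tuple S(2), of fst]
    unfolding compact_space_def by (intro image_compactin) auto
  moreover have "(\<lambda>z. image_tp l b (fst z)) ` topspace (pair_space S) = topspace (type_space l b)"
    unfolding topspace_pair_space topspace_image_types[OF b_tuple] by force
  ultimately show ?thesis by (simp add: compact_space_def)
qed

lemma topspace_Gal: "topspace (Gal_topology C \<kappa> \<alpha> e \<eta> \<Sigma> l b) = carrier Gal"
  unfolding Gal_topology_def using nu_image by (simp add: topspace_quotient_topology)

text \<open>
  The map \<open>(f, g) \<mapsto> tp(f(b)/b)\<close> from a compact to a Hausdorff space is closed, so a set of types is closed iff its
  preimage is. The right-hand side depends on \<open>b\<close> only through the choice of \<open>S\<close>.
\<close>
lemma closedin_Gal:
  assumes S: "represents_e S" "entries \<kappa> l \<eta> b \<subseteq> S"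
  shows "closedin (Gal_topology C \<kappa> \<alpha> e \<eta> \<Sigma> l b) F \<longleftrightarrow>
    F \<subseteq> carrier Gal \<and> closedin (pair_space S) {z \<in> G \<times> G. gal (fst z) \<in> F}"
proof -
  let ?\<pi> = "\<lambda>z. image_tp l b (fst z)"
  have cont: "continuous_map (pair_space S) (type_space l b) ?\<pi>"
    using continuous_type[OF b_tuple S(2), of fst] by simp
  have closed: "closed_map (pair_space S) (type_space l b) ?\<pi>"
    using continuous_imp_closed_map[OF cont compact_pair_space[OF S(1)] Hausdorff_image_types] .
  have image: "?\<pi> ` {z \<in> G \<times> G. gal (fst z) \<in> F} = {p \<in> topspace (type_space l b). \<nu> p \<in> F}"
  proof (intro subset_antisym subsetI)
    fix p assume "p \<in> {p \<in> topspace (type_space l b). \<nu> p \<in> F}"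
    then obtain f where "f \<in> G" "p = image_tp l b f" "gal f \<in> F"
      using topspace_image_types[OF b_tuple] nu_image_tp[OF lascar dcl] by auto
    then show "p \<in> ?\<pi> ` {z \<in> G \<times> G. gal (fst z) \<in> F}" by (intro image_eqI[of _ _ "(f, f)"]) auto
  qed (use topspace_image_types[OF b_tuple] nu_image_tp[OF lascar dcl] in auto)
  have preimage: "{z \<in> topspace (pair_space S). ?\<pi> z \<in> {p \<in> topspace (type_space l b). \<nu> p \<in> F}} = {z \<in> G \<times> G. gal (fst z) \<in> F}"
    using topspace_image_types[OF b_tuple] nu_image_tp[OF lascar dcl] by (auto simp: topspace_pair_space)
  have "closedin (type_space l b) {p \<in> topspace (type_space l b). \<nu> p \<in> F} \<longleftrightarrow>
      closedin (pair_space S) {z \<in> G \<times> G. gal (fst z) \<in> F}"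
    (is "closedin _ ?P \<longleftrightarrow> closedin _ ?Z")
  proof
    assume "closedin (type_space l b) ?P"
    from closedin_continuous_map_preimage[OF cont this] show "closedin (pair_space S) ?Z"
      by (simp only: preimage)
  next
    assume "closedin (pair_space S) ?Z"
    with closed have "closedin (type_space l b) (?\<pi> ` ?Z)" by (simp add: closed_map_def)
    then show "closedin (type_space l b) ?P" by (simp only: image)
  qed
  then show ?thesis
    unfolding Gal_topology_def using closedin_quotient_topology[of \<nu> "type_space l b" "carrier Gal" F] nu_image by simp
qed

lemma compact_Gal: "compact_space (Gal_topology C \<kappa> \<alpha> e \<eta> \<Sigma> l b)"
proof -
  have "continuous_map (type_space l b) (Gal_topology C \<kappa> \<alpha> e \<eta> \<Sigma> l b) \<nu>"
    unfolding Gal_topology_def using nu_image by (intro continuous_map_quotient_topology) simp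
  from image_compactin[OF _ this, of "topspace (type_space l b)"]
  show ?thesis using compact_image_types nu_image topspace_Gal by (simp add: compact_space_def)
qed

lemma topological_group_Gal: "topological_group Gal (Gal_topology C \<kappa> \<alpha> e \<eta> \<Sigma> l b)"
  unfolding Gal_topology_def
proof (rule topological_group_quotient[OF Gal_group compact_image_types nu_image], fold Gal_topology_def)
  fix F assume F: "closedin (Gal_topology C \<kappa> \<alpha> e \<eta> \<Sigma> l b) F"
  obtain S where S: "represents_e S" "entries \<kappa> l \<eta> b \<subseteq> S"
    using small_representing_set[OF entries_small[OF l_Field]] by blast
  let ?W = "{z \<in> G \<times> G. gal (inv_into UNIV (fst z) \<circ> snd z) \<in> F}"
  let ?\<pi> = "\<lambda>z. (image_tp l b (fst z), image_tp l b (snd z))"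
  have "closedin (pair_space S) {z \<in> G \<times> G. gal (fst z) \<in> F}" using F closedin_Gal[OF S] by blast
  from closedin_continuous_map_preimage[OF continuous_division this]
  have "closedin (pair_space S) {z \<in> G \<times> G. (case z of (f, g) \<Rightarrow> (inv_into UNIV f \<circ> g, id)) \<in> {z \<in> G \<times> G. gal (fst z) \<in> F}}"
    by (simp only: topspace_pair_space)
  moreover have "{z \<in> G \<times> G. (case z of (f, g) \<Rightarrow> (inv_into UNIV f \<circ> g, id)) \<in> {z \<in> G \<times> G. gal (fst z) \<in> F}} = ?W"
    using G_comp G_inv G_id by auto
  ultimately have W: "closedin (pair_space S) ?W" by simp
  have "continuous_map (pair_space S) (prod_topology (type_space l b) (type_space l b)) ?\<pi>"
    using continuous_type[OF b_tuple S(2)] by (intro continuous_map_pairedI) auto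
  moreover have "Hausdorff_space (prod_topology (type_space l b) (type_space l b))"
    using Hausdorff_image_types by (simp add: Hausdorff_space_prod_topology)
  ultimately have "closed_map (pair_space S) (prod_topology (type_space l b) (type_space l b)) ?\<pi>"
    using continuous_imp_closed_map compact_pair_space[OF S(1)] by blast
  then have "closedin (prod_topology (type_space l b) (type_space l b)) (?\<pi> ` ?W)" using W unfolding closed_map_def by blast
  moreover have "?\<pi> ` ?W = {(p, r). p \<in> topspace (type_space l b) \<and> r \<in> topspace (type_space l b) \<and> inv\<^bsub>Gal\<^esub> (\<nu> p) \<otimes>\<^bsub>Gal\<^esub> \<nu> r \<in> F}" (is "_ = ?R")
  proof -
    have gal_div: "inv\<^bsub>Gal\<^esub> (\<nu> (image_tp l b f)) \<otimes>\<^bsub>Gal\<^esub> \<nu> (image_tp l b g) = gal (inv_into UNIV f \<circ> g)" if "f \<in> G" "g \<in> G" for f g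
      using that nu_image_tp[OF lascar dcl] gal_comp[OF G_inv] gal_inv by simp
    show ?thesis
    proof (intro subset_antisym subsetI)
      fix z assume "z \<in> ?\<pi> ` ?W"
      then obtain w where w: "z = ?\<pi> w" "w \<in> ?W" by (rule imageE)
      obtain f g where "w = (f, g)" by (cases w)
      with w have fg: "f \<in> G" "g \<in> G" "z = (image_tp l b f, image_tp l b g)" "gal (inv_into UNIV f \<circ> g) \<in> F" by simp_all
      then show "z \<in> ?R" using gal_div[OF fg(1,2)] topspace_image_types[OF b_tuple] by simp
    next
      fix z assume "z \<in> ?R"
      then obtain p r where "z = (p, r)" "p \<in> topspace (type_space l b)" "r \<in> topspace (type_space l b)" "inv\<^bsub>Gal\<^esub> (\<nu> p) \<otimes>\<^bsub>Gal\<^esub> \<nu> r \<in> F"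
        by blast
      moreover from this obtain f g where fg: "f \<in> G" "p = image_tp l b f" "g \<in> G" "r = image_tp l b g"
        unfolding topspace_image_types[OF b_tuple] by blast
      ultimately have "z = ?\<pi> (f, g)" "(f, g) \<in> ?W" using gal_div[OF fg(1,3)] by simp_all
      then show "z \<in> ?\<pi> ` ?W" by (rule image_eqI)
    qed
  qed
  ultimately show "closedin (prod_topology (type_space l b) (type_space l b)) ?R" by simp
qed

end

lemma (in galois_setting) Gal_topology_independent:
  assumes "lascar_setting C T \<kappa> \<alpha> \<eta> e \<Sigma> l b" and "lascar_setting C T \<kappa> \<alpha> \<eta> e \<Sigma> l' b'"
  shows "Gal_topology C \<kappa> \<alpha> e \<eta> \<Sigma> l b = Gal_topology C \<kappa> \<alpha> e \<eta> \<Sigma> l' b'"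
proof -
  interpret left: lascar_setting C T \<kappa> \<alpha> \<eta> e \<Sigma> l b by fact
  interpret right: lascar_setting C T \<kappa> \<alpha> \<eta> e \<Sigma> l' b' by fact
  have "|entries \<kappa> l \<eta> b \<union> entries \<kappa> l' \<eta> b'| <o \<kappa>"
    by (rule small_Un[OF card_order uncountable entries_small[OF left.l_Field] entries_small[OF right.l_Field]])
  then obtain S where S: "represents_e S" "entries \<kappa> l \<eta> b \<union> entries \<kappa> l' \<eta> b' \<subseteq> S"
    using small_representing_set by blast
  have closed_iff: "closedin (Gal_topology C \<kappa> \<alpha> e \<eta> \<Sigma> l b) F \<longleftrightarrow> closedin (Gal_topology C \<kappa> \<alpha> e \<eta> \<Sigma> l' b') F" for F
    using left.closedin_Gal[OF S(1)] right.closedin_Gal[OF S(1)] S(2) by simp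
  show ?thesis
    unfolding topology_eq openin_closedin_eq left.topspace_Gal right.topspace_Gal
    by (simp only: closed_iff simp_thms)
qed

theorem mainTheorem3:
  fixes C :: "('f, 'r, 'a) fo_structure" and T :: "('f, 'r, nat) form set" and \<kappa> :: "'k rel"
    and \<alpha> \<eta> :: 'k and e :: "('k \<Rightarrow> 'a) set" and \<Sigma> :: "('f, 'r, 'k + 'a) form set"
  assumes "monster_model C T \<kappa>"
    and "hyperimaginary C \<kappa> \<alpha> e"
    and "partial_type C \<kappa> \<eta> \<Sigma>"
    and "e_invariant C \<kappa> \<alpha> e \<eta> \<Sigma>"
    and "\<exists>l b. lascar_tuple C \<kappa> \<alpha> e \<eta> \<Sigma> l b \<and> in_dcl C \<kappa> \<alpha> e (entries \<kappa> l \<eta> b)"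
  shows "(\<forall>l b. lascar_tuple C \<kappa> \<alpha> e \<eta> \<Sigma> l b \<and> in_dcl C \<kappa> \<alpha> e (entries \<kappa> l \<eta> b) \<longrightarrow>
            compact_space (Gal_topology C \<kappa> \<alpha> e \<eta> \<Sigma> l b) \<and>
            topological_group (Gal_L C \<kappa> \<alpha> e \<eta> \<Sigma>) (Gal_topology C \<kappa> \<alpha> e \<eta> \<Sigma> l b)) \<and>
         (\<forall>l b l' b'. lascar_tuple C \<kappa> \<alpha> e \<eta> \<Sigma> l b \<and> in_dcl C \<kappa> \<alpha> e (entries \<kappa> l \<eta> b) \<and>
            lascar_tuple C \<kappa> \<alpha> e \<eta> \<Sigma> l' b' \<and> in_dcl C \<kappa> \<alpha> e (entries \<kappa> l' \<eta> b') \<longrightarrow>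
            Gal_topology C \<kappa> \<alpha> e \<eta> \<Sigma> l b = Gal_topology C \<kappa> \<alpha> e \<eta> \<Sigma> l' b')"
proof -
  interpret galois_setting C T \<kappa> \<alpha> \<eta> e \<Sigma>
    using assms(1-4) by unfold_locales
  have setting: "lascar_setting C T \<kappa> \<alpha> \<eta> e \<Sigma> l b"
    if "lascar_tuple C \<kappa> \<alpha> e \<eta> \<Sigma> l b" "in_dcl C \<kappa> \<alpha> e (entries \<kappa> l \<eta> b)" for l b
    using that by unfold_locales
  show ?thesis
  proof (intro conjI allI impI; elim conjE)
    fix l b
    assume "lascar_tuple C \<kappa> \<alpha> e \<eta> \<Sigma> l b" "in_dcl C \<kappa> \<alpha> e (entries \<kappa> l \<eta> b)"
    then interpret lascar_setting C T \<kappa> \<alpha> \<eta> e \<Sigma> l b by (rule setting)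
    show "compact_space (Gal_topology C \<kappa> \<alpha> e \<eta> \<Sigma> l b)" by (rule compact_Gal)
    show "topological_group (Gal_L C \<kappa> \<alpha> e \<eta> \<Sigma>) (Gal_topology C \<kappa> \<alpha> e \<eta> \<Sigma> l b)"
      by (rule topological_group_Gal)
  next
    fix l b l' b'
    assume "lascar_tuple C \<kappa> \<alpha> e \<eta> \<Sigma> l b" "in_dcl C \<kappa> \<alpha> e (entries \<kappa> l \<eta> b)"
      "lascar_tuple C \<kappa> \<alpha> e \<eta> \<Sigma> l' b'" "in_dcl C \<kappa> \<alpha> e (entries \<kappa> l' \<eta> b')"
    then show "Gal_topology C \<kappa> \<alpha> e \<eta> \<Sigma> l b = Gal_topology C \<kappa> \<alpha> e \<eta> \<Sigma> l' b'"
      by (intro Gal_topology_independent setting)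
  qed
qed

end
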